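(* Fix a polynomially bounded o-minimal expansion of $\mathbb{R}$. Let $\mathcal{A}$ be a definable family of subsets of $\mathbb{R}^n$ parametrized by the definable set $A$, and let $\mathcal{B}$ be a definable family of subsets of $\mathbb{R}^{n+1}$ parametrized by the definable set $B$. Then there exists $N = N(\mathcal{A},\mathcal{B}) > 0$ having the following property. For any triple of finite sets $(A',B',B'')$ with $A' \subset A$, $B',B'' \subset B$, any closed $(\mathcal{A},A')$-set $S$, any $(\mathcal{B},B')$-set $F$ and any $(\mathcal{B},B'')$-set $G$ such that $F,G$ are graphs of definable functions $f,g:\mathbb{R}^n \rightarrow \mathbb{R}$ that are continuous on $S$ and satisfy $f|_S^{-1}(0) \subset g|_S^{-1}(0)$, there exists a continuous definable function $h:S \rightarrow \mathbb{R}$ such that $g|_S^N = h\, f|_S$ on $S$.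
   Context: An o-minimal expansion of $\mathbb{R}$ is polynomially bounded if for every definable $h:\mathbb{R}\to\mathbb{R}$ there exist $N\in\mathbb{N}$, $c\in\mathbb{R}$ with $|h(x)|<x^N$ for all $x>c$. A definable family of subsets of $\mathbb{R}^n$ parametrized by a definable set $A$ is a definable subset $\mathcal{A}\subset A\times\mathbb{R}^n$; for $a\in A$, $\mathcal{A}_a=\{y : (a,y)\in\mathcal{A}\}$. For a finite $A'\subset A$, an $(\mathcal{A},A')$-set is any set in the Boolean algebra of subsets of $\mathbb{R}^n$ generated by the sets $\mathcal{A}_a$, $a\in A'$. *)

theory Defs
  imports Main Complex_Main
begin

text \<open>Points of R^n are represented as real lists of length n.
  A structure on R is a map D assigning to each n the collection D n of
  definable subsets of R^n.\<close>

definition Rn :: "nat \<Rightarrow> real list set" where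
  "Rn n = {xs. length xs = n}"

definition basic_interval :: "real set \<Rightarrow> bool" where
  "basic_interval I \<longleftrightarrow>
     (\<exists>a. I = {a}) \<or> (\<exists>a b. a < b \<and> I = {a<..<b}) \<or>
     (\<exists>a. I = {a<..}) \<or> (\<exists>b. I = {..<b}) \<or> I = UNIV"

text \<open>An o-minimal expansion of the ordered real field (definability with
  parameters: all singletons are definable).\<close>
definition o_minimal_expansion :: "(nat \<Rightarrow> real list set set) \<Rightarrow> bool" where
  "o_minimal_expansion D \<longleftrightarrow>
     (\<forall>n X. X \<in> D n \<longrightarrow> X \<subseteq> Rn n) \<and>
     (\<forall>n. {} \<in> D n) \<and>
     (\<forall>n X. X \<in> D n \<longrightarrow> Rn n - X \<in> D n) \<and>
     (\<forall>n X Y. X \<in> D n \<longrightarrow> Y \<in> D n \<longrightarrow> X \<union> Y \<in> D n) \<and>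
     (\<forall>n X. X \<in> D n \<longrightarrow> {xs @ [y] | xs y. xs \<in> X} \<in> D (Suc n)) \<and>
     (\<forall>n X. X \<in> D n \<longrightarrow> {y # xs | xs y. xs \<in> X} \<in> D (Suc n)) \<and>
     (\<forall>n i j. i < j \<and> j < n \<longrightarrow> {xs \<in> Rn n. xs ! i = xs ! j} \<in> D n) \<and>
     (\<forall>n X. X \<in> D (Suc n) \<longrightarrow> butlast ` X \<in> D n) \<and>
     {[x, y] | x y. x < y} \<in> D 2 \<and>
     {[x, y, z] | x y z. z = x + y} \<in> D 3 \<and>
     {[x, y, z] | x y z. z = x * y} \<in> D 3 \<and>
     (\<forall>r. {[r]} \<in> D 1) \<and>
     (\<forall>X \<in> D 1. \<exists>\<I>. finite \<I> \<and> (\<forall>I\<in>\<I>. basic_interval I) \<and>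
        X = {[x] | x. x \<in> \<Union>\<I>})"

definition lgraph_on :: "real list set \<Rightarrow> (real list \<Rightarrow> real) \<Rightarrow> real list set" where
  "lgraph_on S f = {xs @ [f xs] | xs. xs \<in> S}"

definition polynomially_bounded :: "(nat \<Rightarrow> real list set set) \<Rightarrow> bool" where
  "polynomially_bounded D \<longleftrightarrow>
     (\<forall>h :: real \<Rightarrow> real. {[x, h x] | x. True} \<in> D 2 \<longrightarrow>
        (\<exists>(N::nat) (c::real). \<forall>x>c. \<bar>h x\<bar> < x ^ N))"

definition fiber :: "real list set \<Rightarrow> real list \<Rightarrow> real list set" where
  "fiber \<A> a = {y. a @ y \<in> \<A>}"

inductive_set bool_alg :: "nat \<Rightarrow> real list set set \<Rightarrow> real list set set"
  for n :: nat and \<G> :: "real list set set" where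
  gen: "X \<in> \<G> \<Longrightarrow> X \<in> bool_alg n \<G>"
| empty: "{} \<in> bool_alg n \<G>"
| compl: "X \<in> bool_alg n \<G> \<Longrightarrow> Rn n - X \<in> bool_alg n \<G>"
| union: "X \<in> bool_alg n \<G> \<Longrightarrow> Y \<in> bool_alg n \<G> \<Longrightarrow> X \<union> Y \<in> bool_alg n \<G>"

definition ldist :: "real list \<Rightarrow> real list \<Rightarrow> real" where
  "ldist xs ys = sqrt (\<Sum>i<length xs. (xs ! i - ys ! i)^2)"

definition lclosed :: "nat \<Rightarrow> real list set \<Rightarrow> bool" where
  "lclosed n S \<longleftrightarrow> S \<subseteq> Rn n \<and>
     (\<forall>x\<in>Rn n. (\<forall>e>0. \<exists>y\<in>S. ldist x y < e) \<longrightarrow> x \<in> S)"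

definition lcont_on :: "real list set \<Rightarrow> (real list \<Rightarrow> real) \<Rightarrow> bool" where
  "lcont_on S f \<longleftrightarrow>
     (\<forall>x\<in>S. \<forall>e>0. \<exists>d>0. \<forall>y\<in>S. ldist x y < d \<longrightarrow> \<bar>f y - f x\<bar> < e)"

end

theory Submission
  imports Defs "HOL-Analysis.Analysis"
begin

text \<open>Only boundedly many parameters matter at a time. By induction on the dimension, every point lies
  in a cell that is contained in an atom of the Boolean algebra generated by the \<open>\<A>\<^sub>a\<close>,
  \<open>a \<in> A'\<close>, and is the fibre of one of finitely many definable families at a tuple from \<open>A'\<close>
  of bounded length: over a point of the base the cell is a boundary point, or an interval between
  neighbouring boundary points, of the fibres. This needs uniform finiteness, which over the reals
  follows from the uncountability of intervals.

  So \<open>S\<close> and the two graphs are finite unions of cells from fixed families. The quotient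
  \<open>g\<^sup>N / f\<close> extends continuously by \<open>0\<close> to a zero \<open>x0\<close> of \<open>f\<close> as soon as
  \<open>\<bar>g\<bar>\<close> to the power \<open>N - 1\<close> is at most \<open>\<bar>f\<bar>\<close> near \<open>x0\<close> on each cell where
  \<open>g \<noteq> 0\<close>. This is a statement about the growth of the one-variable function
  \<open>x \<mapsto> sup {1/\<bar>f\<bar> | \<bar>g\<bar> \<ge> 1/x}\<close>, which ranges over a definable family. If the growth
  factors from \<open>x\<close> to \<open>2 x\<close> at infinity were unbounded over that family, a diagonal choice of the
  parameter would produce a definable function of superpolynomial growth.\<close>

section \<open>First-order definability\<close>

text \<open>The obstacle is that \<open>A'\<close>, \<open>B'\<close> and \<open>B''\<close> are
  arbitrarily large, so the sets they generate need not form one definable family. What rescues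
  uniformity is that a single cell uses a number of parameters fixed by the families alone, while a
  larger \<open>A'\<close> merely yields more cells. Their number matters only when finitely many
  neighbourhoods of one point are intersected, which leaves the exponent untouched. Cells may
  overlap and be disconnected; all that is asked of them is that membership in every fibre be
  constant along them. The quotient is studied at one point at a time because \<open>S\<close> may
  be unbounded: the point \<open>x0\<close> becomes a further parameter of the family, and a box
  about it supplies the compactness that keeps \<open>f\<close> away from 0 where \<open>g\<close>
  is not small. In the growth argument no parameter is chosen as a function of \<open>s\<close>:
  only two real bounds are selected, by infima, and the parameter stays behind an existential
  quantifier.\<close>

locale o_minimal =
  fixes D :: "nat \<Rightarrow> real list set set"
  assumes o_minimal: "o_minimal_expansion D"
begin

lemma D_subset: "X \<in> D n \<Longrightarrow> X \<subseteq> Rn n"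
  and D_empty: "{} \<in> D n"
  and D_Compl: "X \<in> D n \<Longrightarrow> Rn n - X \<in> D n"
  and D_Un: "X \<in> D n \<Longrightarrow> Y \<in> D n \<Longrightarrow> X \<union> Y \<in> D n"
  and D_Cons: "X \<in> D n \<Longrightarrow> {y # xs | xs y. xs \<in> X} \<in> D (Suc n)"
  and D_diagonal: "i < j \<Longrightarrow> j < n \<Longrightarrow> {xs \<in> Rn n. xs ! i = xs ! j} \<in> D n"
  and D_butlast: "X \<in> D (Suc n) \<Longrightarrow> butlast ` X \<in> D n"
  and D_less: "{[x, y] | x y. x < y} \<in> D 2"
  and D_add: "{[x, y, z] | x y z. z = x + y} \<in> D 3"
  and D_mult: "{[x, y, z] | x y z. z = x * y} \<in> D 3"
  and D_singleton: "{[r]} \<in> D 1"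
  and D_1_finite_union: "X \<in> D 1 \<Longrightarrow>
    \<exists>\<I>. finite \<I> \<and> (\<forall>I\<in>\<I>. basic_interval I) \<and> X = {[x] | x. x \<in> \<Union>\<I>}"
  by (insert o_minimal[unfolded o_minimal_expansion_def], (elim conjE, simp only: simp_thms)+)

lemma D_length: "X \<in> D n \<Longrightarrow> xs \<in> X \<Longrightarrow> length xs = n"
  using D_subset by (auto simp: Rn_def)

lemma D_Int: assumes "X \<in> D n" "Y \<in> D n" shows "X \<inter> Y \<in> D n"
proof -
  have "X \<inter> Y = Rn n - ((Rn n - X) \<union> (Rn n - Y))"
    using D_subset assms by blast
  then show ?thesis using assms D_Compl D_Un by metis
qed

lemma D_Rn: "Rn n \<in> D n"
  using D_Compl[OF D_empty] by simp

section \<open>Projections and pullbacks along maps of coordinates\<close>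

lemma D_prepend: "X \<in> D n \<Longrightarrow> {as @ xs | as xs. length as = m \<and> xs \<in> X} \<in> D (m + n)"
proof (induction m)
  case 0
  then show ?case by simp
next
  case (Suc m)
  have "{as @ xs | as xs. length as = Suc m \<and> xs \<in> X} =
      {y # zs | zs y. zs \<in> {as @ xs | as xs. length as = m \<and> xs \<in> X}}"
    by (auto simp: length_Suc_conv) (metis append_Cons)+
  then show ?case using D_Cons[OF Suc.IH[OF Suc.prems]] by simp
qed

lemma D_take: "X \<in> D (m + n) \<Longrightarrow> take m ` X \<in> D m"
proof (induction n arbitrary: X)
  case 0
  then have "take m ` X = X" using D_length by (force simp: image_iff)
  then show ?case using 0 by simp
next
  case (Suc n)
  have "take m ` (butlast ` X) \<in> D m"
    using Suc D_butlast by simp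
  moreover have "take m ` (butlast ` X) = take m ` X"
    unfolding image_image
    by (rule image_cong[OF refl]) (use D_length[OF Suc.prems] in \<open>auto simp: butlast_conv_take\<close>)
  ultimately show ?case by simp
qed

text \<open>The graph of the coordinate map is cut out of R^(m+n) by diagonals, one for each of the
  \<open>n\<close> target coordinates, and these coordinates are then projected away. Repetitions
  and omissions of coordinates are both covered.\<close>

lemma D_reindex:
  assumes X: "X \<in> D n" and \<sigma>: "\<And>i. i < n \<Longrightarrow> \<sigma> i < m"
  shows "{xs \<in> Rn m. map (\<lambda>i. xs ! \<sigma> i) [0..<n] \<in> X} \<in> D m"
proof -
  define Y where "Y = {as @ xs | as xs. length as = m \<and> xs \<in> X}"
  define Z where "Z k = {zs \<in> Y. \<forall>i<k. zs ! \<sigma> i = zs ! (m + i)}" for k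
  have Y: "Y \<in> D (m + n)" unfolding Y_def by (rule D_prepend[OF X])
  have Z: "k \<le> n \<Longrightarrow> Z k \<in> D (m + n)" for k
  proof (induction k)
    case 0
    then show ?case using Y by (simp add: Z_def)
  next
    case (Suc k)
    have "Z (Suc k) = Z k \<inter> {zs \<in> Rn (m + n). zs ! \<sigma> k = zs ! (m + k)}"
      using D_subset[OF Y] by (auto simp: Z_def less_Suc_eq)
    then show ?case
      using Suc D_Int D_diagonal[of "\<sigma> k" "m + k" "m + n"] \<sigma>[of k] by simp
  qed
  have "take m ` Z n = {xs \<in> Rn m. map (\<lambda>i. xs ! \<sigma> i) [0..<n] \<in> X}"
  proof (intro equalityI subsetI)
    fix as assume "as \<in> take m ` Z n"
    then obtain zs where "zs \<in> Z n" "as = take m zs" by blast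
    then obtain xs where *: "length as = m" "xs \<in> X"
        "\<forall>i<n. (as @ xs) ! \<sigma> i = (as @ xs) ! (m + i)"
      unfolding Z_def Y_def by force
    then have "map (\<lambda>i. as ! \<sigma> i) [0..<n] = xs"
      using D_length[OF X] \<sigma> by (intro nth_equalityI) (auto simp: nth_append)
    then show "as \<in> {xs \<in> Rn m. map (\<lambda>i. xs ! \<sigma> i) [0..<n] \<in> X}"
      using * by (simp add: Rn_def)
  next
    fix as assume as: "as \<in> {xs \<in> Rn m. map (\<lambda>i. xs ! \<sigma> i) [0..<n] \<in> X}"
    then have "as @ map (\<lambda>i. as ! \<sigma> i) [0..<n] \<in> Z n"
      using \<sigma> by (auto simp: Z_def Y_def Rn_def nth_append)
    then show "as \<in> take m ` Z n"
      using as by (force simp: Rn_def image_iff)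
  qed
  then show ?thesis using D_take Z[of n] by fastforce
qed

text \<open>Formulas are predicates on assignments of reals to the variables \<open>0, 1, 2, \<dots>\<close>; a
  quantifier binds variable \<open>0\<close> and shifts the others, in de Bruijn style.\<close>

definition dfn :: "((nat \<Rightarrow> real) \<Rightarrow> bool) \<Rightarrow> bool" where
  "dfn P \<longleftrightarrow> (\<exists>n. \<exists>X\<in>D n. \<forall>e. P e \<longleftrightarrow> map e [0..<n] \<in> X)"

definition dfn_term :: "((nat \<Rightarrow> real) \<Rightarrow> real) \<Rightarrow> bool" where
  "dfn_term t \<longleftrightarrow> dfn (\<lambda>e. e 0 = t (\<lambda>i. e (Suc i)))"

definition dfn_list :: "((nat \<Rightarrow> real) \<Rightarrow> real list) \<Rightarrow> bool" where
  "dfn_list v \<longleftrightarrow> (\<exists>l. (\<forall>e. length (v e) = l) \<and> (\<forall>i<l. dfn_term (\<lambda>e. v e ! i)))"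

lemma dfn_D: "X \<in> D n \<Longrightarrow> dfn (\<lambda>e. map e [0..<n] \<in> X)"
  unfolding dfn_def by blast

section \<open>Closure of formulas under substitution, connectives and quantifiers\<close>

lemma dfn_reindex: assumes "dfn P" shows "dfn (\<lambda>e. P (\<lambda>i. e (\<sigma> i)))"
proof -
  obtain n X where X: "X \<in> D n" "\<And>e. P e \<longleftrightarrow> map e [0..<n] \<in> X"
    using assms unfolding dfn_def by blast
  define m where "m = Suc (Max (insert 0 (\<sigma> ` {..<n})))"
  have m: "\<sigma> i < m" if "i < n" for i
    using that unfolding m_def by (simp add: less_Suc_eq_le Max_ge_iff)
  have "P (\<lambda>i. e (\<sigma> i)) \<longleftrightarrow>
      map e [0..<m] \<in> {xs \<in> Rn m. map (\<lambda>i. xs ! \<sigma> i) [0..<n] \<in> X}" for e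
  proof -
    have "map (\<lambda>i. map e [0..<m] ! \<sigma> i) [0..<n] = map (\<lambda>i. e (\<sigma> i)) [0..<n]"
      using m by (intro map_cong) auto
    then show ?thesis using X(2) by (simp add: Rn_def del: map_eq_conv)
  qed
  then show ?thesis
    unfolding dfn_def by (intro exI[of _ m] bexI[OF _ D_reindex[OF X(1) m]] allI)
qed

text \<open>Dummy coordinates bring formulas of different arity into a common \<open>D m\<close>, as
  conjunction and projection require.\<close>

lemma dfn_enlarge:
  assumes "dfn P"
  obtains n where "\<And>m. n \<le> m \<Longrightarrow> \<exists>X\<in>D m. \<forall>e. P e \<longleftrightarrow> map e [0..<m] \<in> X"
proof -
  obtain n X where X: "X \<in> D n" "\<And>e. P e \<longleftrightarrow> map e [0..<n] \<in> X"
    using assms unfolding dfn_def by blast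
  have "\<exists>X\<in>D m. \<forall>e. P e \<longleftrightarrow> map e [0..<m] \<in> X" if "n \<le> m" for m
  proof
    show "{xs \<in> Rn m. map (\<lambda>i. xs ! i) [0..<n] \<in> X} \<in> D m"
      using D_reindex[OF X(1), of "\<lambda>i. i" m] that by simp
    have "map (\<lambda>i. map e [0..<m] ! i) [0..<n] = map e [0..<n]" for e :: "nat \<Rightarrow> real"
      using that by (intro map_cong) auto
    then show "\<forall>e. P e \<longleftrightarrow> map e [0..<m] \<in> {xs \<in> Rn m. map (\<lambda>i. xs ! i) [0..<n] \<in> X}"
      using X(2) by (simp add: Rn_def del: map_eq_conv)
  qed
  then show thesis using that by blast
qed

lemma dfn_not: assumes "dfn P" shows "dfn (\<lambda>e. \<not> P e)"
proof -
  obtain n X where X: "X \<in> D n" "\<And>e. P e \<longleftrightarrow> map e [0..<n] \<in> X"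
    using assms unfolding dfn_def by blast
  then have "\<not> P e \<longleftrightarrow> map e [0..<n] \<in> Rn n - X" for e
    by (simp add: Rn_def)
  then show ?thesis unfolding dfn_def using D_Compl[OF X(1)] by blast
qed

lemma dfn_conj: assumes "dfn P" "dfn Q" shows "dfn (\<lambda>e. P e \<and> Q e)"
proof -
  obtain m where m: "\<And>k. m \<le> k \<Longrightarrow> \<exists>X\<in>D k. \<forall>e. P e \<longleftrightarrow> map e [0..<k] \<in> X"
    using dfn_enlarge[OF assms(1)] by blast
  obtain n where n: "\<And>k. n \<le> k \<Longrightarrow> \<exists>X\<in>D k. \<forall>e. Q e \<longleftrightarrow> map e [0..<k] \<in> X"
    using dfn_enlarge[OF assms(2)] by blast
  obtain X Y where "X \<in> D (m + n)" "\<forall>e. P e \<longleftrightarrow> map e [0..<m + n] \<in> X"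
      "Y \<in> D (m + n)" "\<forall>e. Q e \<longleftrightarrow> map e [0..<m + n] \<in> Y"
    using m[of "m + n"] n[of "m + n"] by auto
  then show ?thesis unfolding dfn_def
    by (intro exI[of _ "m + n"] bexI[of _ "X \<inter> Y"]) (auto intro: D_Int)
qed

lemma dfn_disj: "dfn P \<Longrightarrow> dfn Q \<Longrightarrow> dfn (\<lambda>e. P e \<or> Q e)"
  using dfn_not[OF dfn_conj[OF dfn_not dfn_not, of P Q]] by simp

lemma dfn_imp: "dfn P \<Longrightarrow> dfn Q \<Longrightarrow> dfn (\<lambda>e. P e \<longrightarrow> Q e)"
  unfolding imp_conv_disj by (intro dfn_disj dfn_not)

lemma dfn_iff: "dfn P \<Longrightarrow> dfn Q \<Longrightarrow> dfn (\<lambda>e. P e = Q e)"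
  unfolding iff_conv_conj_imp by (intro dfn_conj dfn_imp)

lemma dfn_False: "dfn (\<lambda>e. False)"
  using dfn_D[OF D_empty[of 0]] by simp

lemma dfn_constant: "dfn (\<lambda>e. b)"
  using dfn_False dfn_not[OF dfn_False] by (cases b) simp_all

lemma dfn_ex: assumes "dfn (\<lambda>e. Q (\<lambda>i. e (Suc i)) (e 0))" shows "dfn (\<lambda>e. \<exists>y. Q e y)"
proof -
  obtain n where "\<exists>X\<in>D (Suc n). \<forall>e. Q (\<lambda>i. e (Suc i)) (e 0) \<longleftrightarrow> map e [0..<Suc n] \<in> X"
    using dfn_enlarge[OF assms] by (metis lessI less_imp_le)
  then obtain X where X: "X \<in> D (Suc n)"
      "\<And>e. Q (\<lambda>i. e (Suc i)) (e 0) \<longleftrightarrow> map e [0..<Suc n] \<in> X"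
    by blast
  \<comment> \<open>The bound variable is the first coordinate, whereas projection drops the last
    one; \<open>\<sigma>\<close> rotates it to the end.\<close>
  define \<sigma> where "\<sigma> i = (case i of 0 \<Rightarrow> n | Suc j \<Rightarrow> j)" for i
  define Y where "Y = {xs \<in> Rn (Suc n). map (\<lambda>i. xs ! \<sigma> i) [0..<Suc n] \<in> X}"
  have Y: "Y \<in> D (Suc n)"
    unfolding Y_def by (rule D_reindex[OF X(1)]) (auto simp: \<sigma>_def split: nat.split)
  have snoc: "xs @ [y] \<in> Y \<longleftrightarrow> y # xs \<in> X" if "length xs = n" for xs y
  proof -
    have "map (\<lambda>i. (xs @ [y]) ! \<sigma> i) [0..<Suc n] = y # xs"
      using that by (intro nth_equalityI) (auto simp: \<sigma>_def nth_append nth_Cons split: nat.split simp del: upt_Suc)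
    then show ?thesis using that by (simp add: Y_def Rn_def)
  qed
  have "(\<exists>y. Q e y) \<longleftrightarrow> map e [0..<n] \<in> butlast ` Y" for e
  proof -
    have "Q e y \<longleftrightarrow> y # map e [0..<n] \<in> X" for y
    proof -
      have "map (case_nat y e) [0..<Suc n] = y # map e [0..<n]"
        by (intro nth_equalityI) (auto simp: nth_Cons split: nat.split simp del: upt_Suc)
      then show ?thesis using X(2)[of "case_nat y e"] by simp
    qed
    moreover have "map e [0..<n] \<in> butlast ` Y \<longleftrightarrow> (\<exists>y. map e [0..<n] @ [y] \<in> Y)"
    proof
      assume "map e [0..<n] \<in> butlast ` Y"
      then obtain zs where "zs \<in> Y" "map e [0..<n] = butlast zs" by blast
      moreover have "zs \<noteq> []" using D_length[OF Y \<open>zs \<in> Y\<close>] by auto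
      ultimately show "\<exists>y. map e [0..<n] @ [y] \<in> Y" by (metis append_butlast_last_id)
    qed (force simp: image_iff)
    ultimately show ?thesis using snoc by simp
  qed
  then show ?thesis unfolding dfn_def using D_butlast[OF Y] by blast
qed

lemma dfn_all: assumes "dfn (\<lambda>e. Q (\<lambda>i. e (Suc i)) (e 0))" shows "dfn (\<lambda>e. \<forall>y. Q e y)"
proof -
  have "dfn (\<lambda>e. \<not> (\<exists>y. \<not> Q e y))"
    by (rule dfn_not, rule dfn_ex, rule dfn_not, rule assms)
  then show ?thesis by simp
qed

text \<open>Quantification over a point of R^n as a block of \<open>n\<close> quantifiers. The guard
  on the length is what makes it first-order; this is why later definitions attach such a guard to
  each list quantifier separately.\<close>

lemma dfn_ex_list:
  "dfn (\<lambda>e. Q (\<lambda>i. e (i + n)) (map e [0..<n])) \<Longrightarrow> dfn (\<lambda>e. \<exists>xs. length xs = n \<and> Q e xs)"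
proof (induction n arbitrary: Q)
  case 0
  then show ?case by simp
next
  case (Suc n)
  have "dfn (\<lambda>e. \<exists>xs. length xs = n \<and> (\<exists>y. Q e (y # xs)))"
  proof (rule Suc.IH, rule dfn_ex)
    have "map e [0..<Suc n] = e 0 # map (\<lambda>i. e (Suc i)) [0..<n]" for e :: "nat \<Rightarrow> real"
      by (intro nth_equalityI) (auto simp: nth_Cons split: nat.split simp del: upt_Suc)
    then show "dfn (\<lambda>e. Q (\<lambda>i. e (Suc (i + n))) (e 0 # map (\<lambda>i. e (Suc i)) [0..<n]))"
      using Suc.prems by (simp del: upt_Suc)
  qed
  moreover have "(\<exists>xs. length xs = n \<and> (\<exists>y. Q e (y # xs))) \<longleftrightarrow> (\<exists>xs. length xs = Suc n \<and> Q e xs)" for e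
    by (auto simp: length_Suc_conv)
  ultimately show ?case by simp
qed

lemma dfn_all_list:
  assumes "dfn (\<lambda>e. Q (\<lambda>i. e (i + n)) (map e [0..<n]))"
  shows "dfn (\<lambda>e. \<forall>xs. length xs = n \<longrightarrow> Q e xs)"
proof -
  have "dfn (\<lambda>e. \<not> (\<exists>xs. length xs = n \<and> \<not> Q e xs))"
    by (rule dfn_not, rule dfn_ex_list, rule dfn_not, rule assms)
  then show ?thesis by simp
qed

lemma dfn_finite_ball:
  "finite I \<Longrightarrow> (\<And>i. i \<in> I \<Longrightarrow> dfn (P i)) \<Longrightarrow> dfn (\<lambda>e. \<forall>i\<in>I. P i e)"
  by (induction I rule: finite_induct) (simp_all add: dfn_constant dfn_conj)

lemma dfn_finite_bex:
  "finite I \<Longrightarrow> (\<And>i. i \<in> I \<Longrightarrow> dfn (P i)) \<Longrightarrow> dfn (\<lambda>e. \<exists>i\<in>I. P i e)"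
  by (induction I rule: finite_induct) (simp_all add: dfn_constant dfn_disj)

section \<open>Definable terms, lists of terms and atomic formulas\<close>

lemma dfn_var_eq: "dfn (\<lambda>e. e i = e j)"
proof -
  have "dfn (\<lambda>e. map e [0..<2] \<in> {xs \<in> Rn 2. xs ! 0 = xs ! 1})"
    by (rule dfn_D) (rule D_diagonal, auto)
  from dfn_reindex[OF this, of "\<lambda>k. if k = 0 then i else j"] show ?thesis
    by (simp add: Rn_def)
qed

lemma dfn_term_var: "dfn_term (\<lambda>e. e k)"
  unfolding dfn_term_def by (rule dfn_var_eq)

lemma dfn_term_const: "dfn_term (\<lambda>e. r)"
proof -
  have "dfn (\<lambda>e. map e [0..<1] \<in> {[r]})" by (rule dfn_D) (rule D_singleton)
  then show ?thesis by (simp add: dfn_term_def)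
qed

lemma dfn_term_eq_reindex:
  assumes "dfn_term t" shows "dfn (\<lambda>e. e k = t (\<lambda>i. e (\<sigma> i)))"
  using dfn_reindex[OF assms[unfolded dfn_term_def], of "case_nat k \<sigma>"] by simp

lemma dfn_term_reindex: "dfn_term t \<Longrightarrow> dfn_term (\<lambda>e. t (\<lambda>i. e (\<sigma> i)))"
  unfolding dfn_term_def[of "\<lambda>e. t (\<lambda>i. e (\<sigma> i))"]
  by (rule dfn_term_eq_reindex)

lemma dfn_list_reindex: assumes "dfn_list v" shows "dfn_list (\<lambda>e. v (\<lambda>i. e (\<sigma> i)))"
proof -
  obtain l where l: "\<forall>e. length (v e) = l" "\<forall>i<l. dfn_term (\<lambda>e. v e ! i)"
    using assms unfolding dfn_list_def by blast
  have "dfn_term (\<lambda>e. v (\<lambda>i. e (\<sigma> i)) ! i)" if "i < l" for i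
    using dfn_term_reindex[of "\<lambda>e. v e ! i" \<sigma>] l(2) that by simp
  then show ?thesis unfolding dfn_list_def using l(1) by auto
qed

lemma dfn_mem: assumes X: "X \<in> D n" and v: "dfn_list v" shows "dfn (\<lambda>e. v e \<in> X)"
proof -
  obtain l where l: "\<And>e. length (v e) = l" "\<And>i. i < l \<Longrightarrow> dfn_term (\<lambda>e. v e ! i)"
    using v unfolding dfn_list_def by blast
  show ?thesis
  proof (cases "l = n")
    case False
    then have "v e \<notin> X" for e using D_length[OF X, of "v e"] l(1)[of e] by auto
    then show ?thesis using dfn_False by simp
  next
    case True
    \<comment> \<open>Only graphs of terms are given, so substitution is expressed by a point of
      \<open>X\<close> whose coordinates equal the terms.\<close>
    have "dfn (\<lambda>e. \<exists>xs. length xs = n \<and> (\<forall>i\<in>{..<n}. xs ! i = v e ! i) \<and> xs \<in> X)"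
    proof (rule dfn_ex_list, rule dfn_conj[OF dfn_finite_ball dfn_D[OF X]])
      fix i assume "i \<in> {..<n}"
      then show "dfn (\<lambda>e. map e [0..<n] ! i = v (\<lambda>i. e (i + n)) ! i)"
        using dfn_term_eq_reindex[OF l(2), of i i "\<lambda>i. i + n"] True by simp
    qed simp
    moreover have "v e \<in> X \<longleftrightarrow> (\<exists>xs. length xs = n \<and> (\<forall>i\<in>{..<n}. xs ! i = v e ! i) \<and> xs \<in> X)" for e
    proof
      assume "v e \<in> X"
      then show "\<exists>xs. length xs = n \<and> (\<forall>i\<in>{..<n}. xs ! i = v e ! i) \<and> xs \<in> X"
        using l(1) True by blast
    next
      assume "\<exists>xs. length xs = n \<and> (\<forall>i\<in>{..<n}. xs ! i = v e ! i) \<and> xs \<in> X"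
      then obtain xs where "length xs = n" "\<forall>i\<in>{..<n}. xs ! i = v e ! i" "xs \<in> X" by blast
      moreover from this have "xs = v e" using l(1) True by (intro nth_equalityI) auto
      ultimately show "v e \<in> X" by simp
    qed
    ultimately show ?thesis by simp
  qed
qed

lemma dfn_list_Nil: "dfn_list (\<lambda>e. [])"
  unfolding dfn_list_def by simp

lemma dfn_list_append: "dfn_list v \<Longrightarrow> dfn_list w \<Longrightarrow> dfn_list (\<lambda>e. v e @ w e)"
proof -
  assume "dfn_list v" "dfn_list w"
  then obtain l k where *: "\<And>e. length (v e) = l" "\<And>i. i < l \<Longrightarrow> dfn_term (\<lambda>e. v e ! i)"
      "\<And>e. length (w e) = k" "\<And>i. i < k \<Longrightarrow> dfn_term (\<lambda>e. w e ! i)"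
    unfolding dfn_list_def by blast
  have "dfn_term (\<lambda>e. (v e @ w e) ! i)" if "i < l + k" for i
    using *(2)[of i] *(4)[of "i - l"] that by (cases "i < l") (simp_all add: nth_append *)
  then show ?thesis unfolding dfn_list_def using * by (intro exI[of _ "l + k"]) auto
qed

lemma dfn_list_single: "dfn_term t \<Longrightarrow> dfn_list (\<lambda>e. [t e])"
  unfolding dfn_list_def by auto

lemma dfn_list_Cons: "dfn_term t \<Longrightarrow> dfn_list v \<Longrightarrow> dfn_list (\<lambda>e. t e # v e)"
  using dfn_list_append[OF dfn_list_single, of t v] by simp

lemma dfn_list_map: "(\<And>i. dfn_term (\<lambda>e. t e i)) \<Longrightarrow> dfn_list (\<lambda>e. map (\<lambda>i. t e i) is)"
  unfolding dfn_list_def by auto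

lemma dfn_list_const: "dfn_list (\<lambda>e. xs)"
  unfolding dfn_list_def by (auto intro: dfn_term_const)

lemma dfn_less: assumes "dfn_term t" "dfn_term u" shows "dfn (\<lambda>e. t e < u e)"
proof -
  have "dfn (\<lambda>e. [t e, u e] \<in> {[x, y] | x y. x < y})"
    by (rule dfn_mem[OF D_less]) (intro dfn_list_Cons dfn_list_Nil assms)
  then show ?thesis by simp
qed

lemma dfn_le: "dfn_term t \<Longrightarrow> dfn_term u \<Longrightarrow> dfn (\<lambda>e. t e \<le> u e)"
  using dfn_not[OF dfn_less, of u t] by (simp add: not_less)

lemma dfn_eq: "dfn_term t \<Longrightarrow> dfn_term u \<Longrightarrow> dfn (\<lambda>e. t e = u e)"
  unfolding order_eq_iff by (intro dfn_conj dfn_le)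

lemma dfn_list_eq: assumes "dfn_list v" "dfn_list w" shows "dfn (\<lambda>e. v e = w e)"
proof -
  obtain l k where *: "\<And>e. length (v e) = l" "\<And>i. i < l \<Longrightarrow> dfn_term (\<lambda>e. v e ! i)"
      "\<And>e. length (w e) = k" "\<And>i. i < k \<Longrightarrow> dfn_term (\<lambda>e. w e ! i)"
    using assms unfolding dfn_list_def by blast
  have "v e = w e \<longleftrightarrow> l = k \<and> (\<forall>i\<in>{..<min l k}. v e ! i = w e ! i)" for e
    by (auto simp: list_eq_iff_nth_eq *)
  then show ?thesis
    using * by (simp only:) (intro dfn_conj dfn_constant dfn_finite_ball dfn_eq, auto)
qed

lemma dfn_term_add: assumes "dfn_term t" "dfn_term u" shows "dfn_term (\<lambda>e. t e + u e)"
proof -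
  have "dfn (\<lambda>e. [t (\<lambda>i. e (Suc i)), u (\<lambda>i. e (Suc i)), e 0] \<in> {[x, y, z] | x y z. z = x + y})"
    by (rule dfn_mem[OF D_add])
      (intro dfn_list_Cons dfn_list_Nil dfn_term_var dfn_term_reindex[OF assms(1)]
        dfn_term_reindex[OF assms(2)])
  then show ?thesis by (simp add: dfn_term_def)
qed

lemma dfn_term_mult: assumes "dfn_term t" "dfn_term u" shows "dfn_term (\<lambda>e. t e * u e)"
proof -
  have "dfn (\<lambda>e. [t (\<lambda>i. e (Suc i)), u (\<lambda>i. e (Suc i)), e 0] \<in> {[x, y, z] | x y z. z = x * y})"
    by (rule dfn_mem[OF D_mult])
      (intro dfn_list_Cons dfn_list_Nil dfn_term_var dfn_term_reindex[OF assms(1)]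
        dfn_term_reindex[OF assms(2)])
  then show ?thesis by (simp add: dfn_term_def)
qed

lemma dfn_term_diff: "dfn_term t \<Longrightarrow> dfn_term u \<Longrightarrow> dfn_term (\<lambda>e. t e - u e)"
  using dfn_term_add[of t "\<lambda>e. - 1 * u e"] dfn_term_mult[OF dfn_term_const[of "- 1"], of u] by simp

lemma dfn_term_power: "dfn_term t \<Longrightarrow> dfn_term (\<lambda>e. t e ^ k)"
  by (induction k) (simp_all add: dfn_term_const dfn_term_mult)

lemma dfn_term_abs: assumes "dfn_term t" shows "dfn_term (\<lambda>e. \<bar>t e\<bar>)"
proof -
  have "dfn (\<lambda>e. (0 \<le> t (\<lambda>i. e (Suc i)) \<and> e 0 = t (\<lambda>i. e (Suc i))) \<or>
      (t (\<lambda>i. e (Suc i)) < 0 \<and> e 0 = 0 - t (\<lambda>i. e (Suc i))))"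
    by (intro dfn_disj dfn_conj dfn_le dfn_less dfn_eq dfn_term_var dfn_term_const dfn_term_diff
        dfn_term_reindex[OF assms])
  then show ?thesis unfolding dfn_term_def by (rule back_subst[of dfn]) (auto simp: fun_eq_iff)
qed

lemmas dfn_intros = dfn_ex_list dfn_all_list dfn_ex dfn_all dfn_not dfn_conj dfn_disj dfn_imp
  dfn_iff dfn_less dfn_le dfn_eq dfn_term_var dfn_term_const dfn_term_add dfn_term_mult
  dfn_term_diff dfn_term_power dfn_term_abs dfn_list_Nil dfn_list_Cons dfn_list_append
  dfn_list_map dfn_list_const dfn_list_eq

text \<open>The set representing the formula may live in more than \<open>n\<close> coordinates;
  since truth depends only on the first \<open>n\<close>, projecting to these loses nothing.\<close>

lemma D_I:
  assumes "dfn (\<lambda>e. P (map e [0..<n]))"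
  shows "{xs. length xs = n \<and> P xs} \<in> D n"
proof -
  obtain m where "\<And>k. m \<le> k \<Longrightarrow> \<exists>X\<in>D k. \<forall>e. P (map e [0..<n]) \<longleftrightarrow> map e [0..<k] \<in> X"
    using dfn_enlarge[OF assms] by blast
  from this[of "n + m"] obtain X where X: "X \<in> D (n + m)" "\<And>e. P (map e [0..<n]) \<longleftrightarrow> map e [0..<n + m] \<in> X"
    by auto
  have ext: "\<exists>e. map e [0..<k] = xs" if "length xs = k" for xs :: "real list" and k
    using that by (intro exI[of _ "\<lambda>i. xs ! i"] nth_equalityI) auto
  have "{xs. length xs = n \<and> P xs} = take n ` X"
  proof (intro equalityI subsetI)
    fix xs assume "xs \<in> {xs. length xs = n \<and> P xs}"
    then obtain e where "map e [0..<n] = xs" "P xs" using ext by blast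
    then have "map e [0..<n + m] \<in> X" "take n (map e [0..<n + m]) = xs"
      using X(2) by (auto simp: take_map)
    then show "xs \<in> take n ` X" by force
  next
    fix xs assume "xs \<in> take n ` X"
    then obtain zs where zs: "zs \<in> X" "xs = take n zs" by blast
    then obtain e where "map e [0..<n + m] = zs" using ext D_length[OF X(1)] by blast
    moreover from this have "xs = map e [0..<n]" using zs by (auto simp: take_map)
    ultimately show "xs \<in> {xs. length xs = n \<and> P xs}" using X(2) zs by auto
  qed
  then show ?thesis using D_take[OF X(1)] by simp
qed

lemma D_I_append:
  assumes "dfn (\<lambda>e. P (map e [0..<m]) (map e [m..<m + n]))"
  shows "{xs @ ys | xs ys. length xs = m \<and> length ys = n \<and> P xs ys} \<in> D (m + n)"
proof -
  have "dfn (\<lambda>e. P (take m (map e [0..<m + n])) (drop m (map e [0..<m + n])))"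
    using assms by (simp add: take_map drop_map)
  from D_I[OF this] show ?thesis
  proof (rule back_subst[of "\<lambda>X. X \<in> D (m + n)"], intro equalityI subsetI)
    fix zs assume "zs \<in> {xs. length xs = m + n \<and> P (take m xs) (drop m xs)}"
    then show "zs \<in> {xs @ ys | xs ys. length xs = m \<and> length ys = n \<and> P xs ys}"
      by (intro CollectI exI[of _ "take m zs"] exI[of _ "drop m zs"]) auto
  qed auto
qed

lemma D_I_snoc:
  assumes "dfn (\<lambda>e. P (map e [0..<m]) (e m))"
  shows "{xs @ [y] | xs y. length xs = m \<and> P xs y} \<in> D (Suc m)"
proof -
  have "{xs @ ys | xs ys. length xs = m \<and> length ys = 1 \<and> P xs (ys ! 0)} \<in> D (m + 1)"
    using assms by (intro D_I_append) simp
  moreover have "{xs @ ys | xs ys. length xs = m \<and> length ys = 1 \<and> P xs (ys ! 0)} =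
      {xs @ [y] | xs y. length xs = m \<and> P xs y}"
    by (auto simp: length_Suc_conv) (metis nth_Cons_0)
  ultimately show ?thesis by simp
qed

end

section \<open>Definable sets of real numbers\<close>

lemma basic_interval_cases:
  assumes "basic_interval I"
  obtains "finite I" | a b where "a < b" "{a<..<b} \<subseteq> I"
proof -
  consider a where "I = {a}" | a b where "a < b" "I = {a<..<b}" | a where "I = {a<..}"
    | b where "I = {..<b}" | "I = UNIV"
    using assms unfolding basic_interval_def by blast
  then show thesis
  proof cases
    case (3 a)
    then have "{a<..<a + 1} \<subseteq> I" by auto
    then show ?thesis using that(2)[of a "a + 1"] by simp
  next
    case (4 b)
    then have "{b - 1<..<b} \<subseteq> I" by auto
    then show ?thesis using that(2)[of "b - 1" b] by simp
  next
    case 5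
    then show ?thesis using that(2)[of 0 1] by simp
  qed (use that in auto)
qed

lemma basic_interval_finite_frontier:
  assumes "basic_interval I" shows "finite (frontier I)"
proof -
  have "frontier {a<..} = {a}" "frontier {..<a} = {a}" for a :: real
    by (auto simp: frontier_def interior_open)
  then show ?thesis
    using assms unfolding basic_interval_def by (elim disjE exE conjE) (simp_all add: frontier_def interior_open)
qed

lemma basic_interval_eventually:
  assumes "basic_interval I"
  shows "(\<forall>\<^sub>F x in at_top. x \<in> I) \<or> (\<forall>\<^sub>F x in at_top. x \<notin> I)"
proof -
  consider b where "I \<subseteq> {..b}" | b where "{b<..} \<subseteq> I"
  proof -
    consider a where "I = {a}" | a b where "I = {a<..<b}" | a where "I = {a<..}"
      | b where "I = {..<b}" | "I = UNIV"
      using assms unfolding basic_interval_def by blast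
    then show thesis
      using that by cases (auto simp: subset_iff intro: less_imp_le)
  qed
  then show ?thesis
  proof cases
    case (1 b)
    have "\<forall>\<^sub>F x in at_top. x \<notin> I"
      using eventually_gt_at_top[of b] by eventually_elim (use 1 in auto)
    then show ?thesis ..
  next
    case (2 b)
    have "\<forall>\<^sub>F x in at_top. x \<in> I"
      using eventually_gt_at_top[of b] by eventually_elim (use 2 in auto)
    then show ?thesis ..
  qed
qed

lemma frontier_Union_subset_finite:
  fixes \<I> :: "real set set"
  shows "finite \<I> \<Longrightarrow> frontier (\<Union>\<I>) \<subseteq> \<Union>(frontier ` \<I>)"
proof (induction rule: finite_induct)
  case (insert I \<I>)
  then show ?case using frontier_Un_subset[of I "\<Union>\<I>"] by auto
qed simp

text \<open>Having equally many elements is not first-order for finite sets of unbounded size. A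
  pairing within a common distance is first-order, and it forces equal cardinality.\<close>

definition matched :: "real set \<Rightarrow> real set \<Rightarrow> bool" where
  "matched A B \<longleftrightarrow> (\<exists>\<epsilon>. (\<forall>y\<in>A. \<exists>!z. z \<in> B \<and> \<bar>z - y\<bar> < \<epsilon>) \<and> (\<forall>z\<in>B. \<exists>!y. y \<in> A \<and> \<bar>z - y\<bar> < \<epsilon>))"

definition locally_matched :: "(real \<Rightarrow> real set) \<Rightarrow> real \<Rightarrow> bool" where
  "locally_matched F u \<longleftrightarrow> (\<exists>\<delta>>0. \<forall>v. \<bar>v - u\<bar> < \<delta> \<longrightarrow> matched (F u) (F v))"

lemma matched_card: assumes "matched A B" shows "card A = card B"
proof -
  obtain \<epsilon> where 1: "\<forall>y\<in>A. \<exists>!z. z \<in> B \<and> \<bar>z - y\<bar> < \<epsilon>" and 2: "\<forall>z\<in>B. \<exists>!y. y \<in> A \<and> \<bar>z - y\<bar> < \<epsilon>"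
    using assms unfolding matched_def by blast
  obtain h where h: "\<And>y. y \<in> A \<Longrightarrow> h y \<in> B \<and> \<bar>h y - y\<bar> < \<epsilon>" using 1 by metis
  have "bij_betw h A B"
    unfolding bij_betw_def
  proof
    show "inj_on h A" using h 2 by (intro inj_onI) metis
    show "h ` A = B" using h 1 2 by (auto simp: image_iff) metis
  qed
  then show ?thesis by (rule bij_betw_same_card)
qed

text \<open>The cardinality is locally constant on an interval, which is connected.\<close>

lemma card_eq_if_locally_matched:
  assumes "\<And>v. v \<in> {min u w..max u w} \<Longrightarrow> locally_matched F v"
  shows "card (F u) = card (F w)"
proof (rule connected_local_const[of "{min u w..max u w}" _ _ "\<lambda>v. card (F v)"])
  show "\<forall>v\<in>{min u w..max u w}. \<forall>\<^sub>F v' in at v within {min u w..max u w}. card (F v) = card (F v')"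
  proof
    fix v assume "v \<in> {min u w..max u w}"
    then obtain \<delta> where "\<delta> > 0" "\<And>v'. \<bar>v' - v\<bar> < \<delta> \<Longrightarrow> matched (F v) (F v')"
      using assms unfolding locally_matched_def by blast
    then show "\<forall>\<^sub>F v' in at v within {min u w..max u w}. card (F v) = card (F v')"
      unfolding eventually_at dist_real_def using matched_card by blast
  qed
qed auto

section \<open>Countably many patterns for finite sets of reals\<close>

lemma finite_set_separated:
  fixes Y :: "real set"
  assumes "finite Y"
  shows "\<exists>n::nat. \<forall>y\<in>Y. \<forall>y'\<in>Y. y \<noteq> y' \<longrightarrow> 2 \<le> \<bar>y - y'\<bar> * real (Suc n)"
proof -
  \<comment> \<open>The inserted 1 keeps the minimum defined when \<open>Y\<close> has at most one
    point.\<close>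
  define d where "d = Min (insert 1 ((\<lambda>(y, y'). \<bar>y - y'\<bar>) ` {p \<in> Y \<times> Y. fst p \<noteq> snd p}))"
  have fin: "finite (insert 1 ((\<lambda>(y, y'). \<bar>y - y'\<bar>) ` {p \<in> Y \<times> Y. fst p \<noteq> snd p}))"
    using assms by simp
  then have "d > 0" unfolding d_def by (subst Min_gr_iff) auto
  then obtain n :: nat where n: "2 / d < real n" using reals_Archimedean2 by blast
  show ?thesis
  proof (intro exI[of _ n] ballI impI)
    fix y y' assume "y \<in> Y" "y' \<in> Y" "y \<noteq> y'"
    then have "d \<le> \<bar>y - y'\<bar>" unfolding d_def by (intro Min_le[OF fin]) force
    moreover have "2 \<le> d * real (Suc n)" using n \<open>d > 0\<close> by (simp add: field_simps)
    ultimately show "2 \<le> \<bar>y - y'\<bar> * real (Suc n)"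
      by (meson mult_right_mono of_nat_0_le_iff order_trans)
  qed
qed

text \<open>For \<open>p = (n, Z)\<close>: the set \<open>Y\<close> is \<open>2/(n+1)\<close>-separated and \<open>Z\<close> is the set of cells of the grid of mesh
  \<open>1/(n+1)\<close> that it meets.\<close>

definition grid_pattern :: "nat \<times> int set \<Rightarrow> real set \<Rightarrow> bool" where
  "grid_pattern p Y \<longleftrightarrow>
     (\<forall>y\<in>Y. \<forall>y'\<in>Y. y \<noteq> y' \<longrightarrow> 2 \<le> \<bar>y - y'\<bar> * real (Suc (fst p))) \<and>
     (\<forall>y\<in>Y. \<exists>i\<in>snd p. of_int i \<le> y * real (Suc (fst p)) \<and> y * real (Suc (fst p)) < of_int i + 1) \<and>
     (\<forall>i\<in>snd p. \<exists>y\<in>Y. of_int i \<le> y * real (Suc (fst p)) \<and> y * real (Suc (fst p)) < of_int i + 1)"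

lemma grid_pattern_exists:
  assumes "finite Y" shows "\<exists>p\<in>UNIV \<times> Collect finite. grid_pattern p Y"
proof -
  obtain n :: nat where n: "\<forall>y\<in>Y. \<forall>y'\<in>Y. y \<noteq> y' \<longrightarrow> 2 \<le> \<bar>y - y'\<bar> * real (Suc n)"
    using finite_set_separated[OF assms] by blast
  have "grid_pattern (n, (\<lambda>y. \<lfloor>y * real (Suc n)\<rfloor>) ` Y) Y"
    unfolding grid_pattern_def fst_conv snd_conv
  proof (intro conjI n ballI)
    fix y assume "y \<in> Y"
    then show "\<exists>i\<in>(\<lambda>y. \<lfloor>y * real (Suc n)\<rfloor>) ` Y. of_int i \<le> y * real (Suc n) \<and> y * real (Suc n) < of_int i + 1"
      by (intro bexI[of _ "\<lfloor>y * real (Suc n)\<rfloor>"]) (linarith | blast)+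
  next
    fix i assume "i \<in> (\<lambda>y. \<lfloor>y * real (Suc n)\<rfloor>) ` Y"
    then obtain y where "y \<in> Y" "i = \<lfloor>y * real (Suc n)\<rfloor>" by blast
    then show "\<exists>y\<in>Y. of_int i \<le> y * real (Suc n) \<and> y * real (Suc n) < of_int i + 1"
      by (intro bexI[of _ y]) (linarith | blast)+
  qed
  then show ?thesis using assms by blast
qed

text \<open>The grid cell of \<open>y\<close> also contains a point \<open>z\<close> of
  \<open>B\<close>. A second point of \<open>B\<close> within one mesh width of \<open>y\<close>
  would be less than two mesh widths from \<open>z\<close>, which the separation by 2
  excludes.\<close>

lemma grid_pattern_close:
  assumes A: "grid_pattern p A" and B: "grid_pattern p B" and y: "y \<in> A"
  shows "\<exists>!z. z \<in> B \<and> \<bar>z - y\<bar> < 1 / real (Suc (fst p))"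
proof -
  define k where "k = real (Suc (fst p))"
  have k: "k > 0" by (simp add: k_def)
  have close: "\<bar>z - y\<bar> < 1 / k \<longleftrightarrow> \<bar>z * k - y * k\<bar> < 1" for z
    using k by (simp add: pos_less_divide_eq abs_mult flip: left_diff_distrib)
  obtain i where i: "i \<in> snd p" "of_int i \<le> y * k" "y * k < of_int i + 1"
    using A y unfolding grid_pattern_def k_def by blast
  then obtain z where z: "z \<in> B" "of_int i \<le> z * k" "z * k < of_int i + 1"
    using B unfolding grid_pattern_def k_def by blast
  have "z' = z" if z': "z' \<in> B" "\<bar>z' * k - y * k\<bar> < 1" for z'
  proof (rule ccontr)
    assume "z' \<noteq> z"
    then have "2 \<le> \<bar>z' - z\<bar> * k"
      using B z(1) z'(1) unfolding grid_pattern_def k_def by blast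
    moreover have "\<bar>z' - z\<bar> * k = \<bar>z' * k - z * k\<bar>"
      using k by (simp add: abs_mult flip: left_diff_distrib)
    ultimately show False using z'(2) z(2,3) i(2,3) by linarith
  qed
  moreover have "\<bar>z * k - y * k\<bar> < 1" using z i by linarith
  ultimately have "\<exists>!z. z \<in> B \<and> \<bar>z * k - y * k\<bar> < 1" using z(1) by blast
  then show ?thesis by (simp only: close flip: k_def)
qed

lemma grid_pattern_matched:
  assumes "grid_pattern p A" "grid_pattern p B" shows "matched A B"
  unfolding matched_def
proof (intro exI[of _ "1 / real (Suc (fst p))"] conjI ballI)
  show "\<exists>!y. y \<in> A \<and> \<bar>z - y\<bar> < 1 / real (Suc (fst p))" if "z \<in> B" for z
    using grid_pattern_close[OF assms(2,1) that] by (simp add: abs_minus_commute)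
qed (rule grid_pattern_close[OF assms])

context o_minimal
begin

lemma dfn_finite_union:
  assumes "dfn (\<lambda>e. P (e 0))"
  obtains \<I> where "finite \<I>" "\<And>I. I \<in> \<I> \<Longrightarrow> basic_interval I" "{x. P x} = \<Union>\<I>"
proof -
  have "{xs. length xs = 1 \<and> P (xs ! 0)} \<in> D 1"
    using assms by (intro D_I) simp
  from D_1_finite_union[OF this] obtain \<I> where \<I>: "finite \<I>" "\<forall>I\<in>\<I>. basic_interval I"
      "{xs. length xs = 1 \<and> P (xs ! 0)} = {[x] | x. x \<in> \<Union>\<I>}" by blast
  have "P x \<longleftrightarrow> [x] \<in> {xs. length xs = 1 \<and> P (xs ! 0)}" for x by simp
  also have "\<dots> x \<longleftrightarrow> x \<in> \<Union>\<I>" for x unfolding \<I>(3) by blast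
  finally have "{x. P x} = \<Union>\<I>" by blast
  then show thesis using that \<I> by blast
qed

lemma dfn_infinite_contains_interval:
  assumes "dfn (\<lambda>e. P (e 0))" "infinite {x. P x}"
  obtains a b where "a < b" "\<And>x. a < x \<Longrightarrow> x < b \<Longrightarrow> P x"
proof -
  obtain \<I> where \<I>: "finite \<I>" "\<And>I. I \<in> \<I> \<Longrightarrow> basic_interval I" "{x. P x} = \<Union>\<I>"
    using dfn_finite_union[OF assms(1)] by blast
  obtain I where "I \<in> \<I>" "infinite I" using assms(2) \<I> by (metis finite_Union)
  then obtain a b where "a < b" "{a<..<b} \<subseteq> I" using \<I>(2) basic_interval_cases by metis
  then have "\<And>x. a < x \<Longrightarrow> x < b \<Longrightarrow> P x" using \<I>(3) \<open>I \<in> \<I>\<close> by (auto simp: set_eq_iff)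
  then show thesis using that \<open>a < b\<close> by blast
qed

lemma dfn_finite_frontier:
  assumes "dfn (\<lambda>e. P (e 0))" shows "finite (frontier {x. P x})"
proof -
  obtain \<I> where \<I>: "finite \<I>" "\<And>I. I \<in> \<I> \<Longrightarrow> basic_interval I" "{x. P x} = \<Union>\<I>"
    using dfn_finite_union[OF assms(1)] by blast
  have "finite (\<Union>(frontier ` \<I>))" using \<I> basic_interval_finite_frontier by blast
  then show ?thesis unfolding \<I>(3) using frontier_Union_subset_finite[OF \<I>(1)] finite_subset by blast
qed

lemma dfn_eventually_or:
  assumes "dfn (\<lambda>e. P (e 0))"
  shows "(\<forall>\<^sub>F x in at_top. P x) \<or> (\<forall>\<^sub>F x in at_top. \<not> P x)"
proof -
  obtain \<I> where \<I>: "finite \<I>" "\<And>I. I \<in> \<I> \<Longrightarrow> basic_interval I" "{x. P x} = \<Union>\<I>"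
    using dfn_finite_union[OF assms(1)] by blast
  have P: "P x \<longleftrightarrow> (\<exists>I\<in>\<I>. x \<in> I)" for x using \<I>(3) by (auto simp: set_eq_iff)
  show ?thesis
  proof (cases "\<exists>I\<in>\<I>. \<forall>\<^sub>F x in at_top. x \<in> I")
    case True
    then obtain I where "I \<in> \<I>" "\<forall>\<^sub>F x in at_top. x \<in> I" by blast
    then have "\<forall>\<^sub>F x in at_top. P x" unfolding P by (auto elim: eventually_mono)
    then show ?thesis ..
  next
    case False
    then have "\<forall>I\<in>\<I>. \<forall>\<^sub>F x in at_top. x \<notin> I" using \<I>(2) basic_interval_eventually by blast
    then have "\<forall>\<^sub>F x in at_top. \<forall>I\<in>\<I>. x \<notin> I" using \<I>(1) by (simp add: eventually_ball_finite)
    then show ?thesis unfolding P by simp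
  qed
qed

text \<open>Completeness of the reals enters here: an interval is uncountable.\<close>

lemma countable_dfn_cover:
  assumes "a < b" and "countable K" and P: "\<And>k. k \<in> K \<Longrightarrow> dfn (\<lambda>e. P k (e 0))"
    and cover: "\<And>x. a < x \<Longrightarrow> x < b \<Longrightarrow> \<exists>k\<in>K. P k x"
  obtains k a' b' where "k \<in> K" "a' < b'" "\<And>x. a' < x \<Longrightarrow> x < b' \<Longrightarrow> a < x \<and> x < b \<and> P k x"
proof -
  have "\<exists>k\<in>K. infinite {x. a < x \<and> x < b \<and> P k x}"
  proof (rule ccontr)
    assume "\<not> ?thesis"
    then have "countable (\<Union>k\<in>K. {x. a < x \<and> x < b \<and> P k x})"
      using \<open>countable K\<close> by (intro countable_UN) (auto intro: countable_finite)
    moreover have "{a<..<b} \<subseteq> (\<Union>k\<in>K. {x. a < x \<and> x < b \<and> P k x})" using cover by fastforce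
    ultimately show False
      using uncountable_open_interval[of a b] \<open>a < b\<close> countable_subset by blast
  qed
  then obtain k where k: "k \<in> K" "infinite {x. a < x \<and> x < b \<and> P k x}" by blast
  have "dfn (\<lambda>e. a < e 0 \<and> e 0 < b \<and> P k (e 0))"
    by (intro dfn_intros P k(1))
  then show thesis
    by (rule dfn_infinite_contains_interval[OF _ k(2)]) (rule that[OF k(1)])
qed

section \<open>Uniform finiteness\<close>

lemma dfn_locally_matched:
  assumes E: "E \<in> D n" and v: "dfn_list v" and t: "dfn_term t"
  shows "dfn (\<lambda>e. locally_matched (\<lambda>u. {y. v e @ [u, y] \<in> E}) (t e))"
  unfolding locally_matched_def matched_def Ball_def Ex1_def mem_Collect_eq
  by (intro dfn_intros dfn_mem[OF E] dfn_list_reindex[OF v] dfn_term_reindex[OF t])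

text \<open>Infinitely many exceptions would fill an interval. There are only countably many grid
  patterns, so one of them persists on a subinterval, and any two fibres with the same pattern are
  matched; the midpoint of that subinterval is then no exception.\<close>

lemma finite_not_locally_matched:
  assumes E: "E \<in> D n" and fin: "\<And>u. finite {y. x @ [u, y] \<in> E}"
  shows "finite {u. \<not> locally_matched (\<lambda>u. {y. x @ [u, y] \<in> E}) u}"
proof (rule ccontr)
  let ?F = "\<lambda>u. {y. x @ [u, y] \<in> E}"
  assume inf: "infinite {u. \<not> locally_matched ?F u}"
  have "dfn (\<lambda>e. \<not> locally_matched ?F (e 0))"
    by (intro dfn_not dfn_locally_matched[OF E] dfn_intros)
  then obtain a b where ab: "a < b" "\<And>u. a < u \<Longrightarrow> u < b \<Longrightarrow> \<not> locally_matched ?F u"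
    using dfn_infinite_contains_interval[OF _ inf] by blast
  have dfn_grid: "dfn (\<lambda>e. grid_pattern p (?F (e 0)))" if "p \<in> UNIV \<times> Collect finite" for p
    unfolding grid_pattern_def Ball_def[of "?F _"] Bex_def[of "?F _"] mem_Collect_eq
    using that by (intro dfn_intros dfn_mem[OF E] dfn_finite_ball dfn_finite_bex) auto
  have "countable (UNIV \<times> Collect finite :: (nat \<times> int set) set)"
    by (intro countable_SIGMA countable_Collect_finite) auto
  from countable_dfn_cover[OF ab(1) this, of "\<lambda>p u. grid_pattern p (?F u)"]
  obtain p a' b' where p: "a' < b'" "\<And>u. a' < u \<Longrightarrow> u < b' \<Longrightarrow> a < u \<and> u < b \<and> grid_pattern p (?F u)"
    using dfn_grid grid_pattern_exists[OF fin] by metis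
  define u where "u = (a' + b') / 2"
  have u: "a' < u" "u < b'" using p(1) by (simp_all add: u_def)
  have "locally_matched ?F u"
    unfolding locally_matched_def
  proof (intro exI[of _ "(b' - a') / 2"] conjI allI impI)
    fix v assume "\<bar>v - u\<bar> < (b' - a') / 2"
    then have "a' < v" "v < b'" by (auto simp: u_def abs_if field_simps split: if_splits)
    then show "matched (?F u) (?F v)" using p(2) u grid_pattern_matched by blast
  qed (use p(1) in simp)
  then show False using ab(2) p(2) u by blast
qed

text \<open>Over a fixed \<open>x\<close> the cardinality of the fibre is constant in
  \<open>u\<close> on each gap between the finitely many exceptional values, so finitely many
  representative values of \<open>u\<close> realise all cardinalities. The union of the fibres at
  these representatives is a definable family over one dimension less, again with finite fibres, and
  its bound serves for \<open>E\<close>.\<close>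

lemma uniform_finiteness:
  assumes "E \<in> D (Suc m)" and "\<And>x. length x = m \<Longrightarrow> finite {y. x @ [y] \<in> E}"
  shows "\<exists>K. \<forall>x. length x = m \<longrightarrow> card {y. x @ [y] \<in> E} \<le> K"
  using assms
proof (induction m arbitrary: E)
  case 0
  then show ?case by auto
next
  case (Suc m)
  define F where "F = (\<lambda>x u. {y. x @ [u, y] \<in> E})"
  define bad where "bad x = {u. \<not> locally_matched (F x) u}" for x
  define rep where "rep x = {w. w = 0 \<or> (\<exists>b. b \<in> bad x \<and> (w = b \<or> w = b + 1 \<or> w = b - 1)) \<or>
    (\<exists>b b'. b \<in> bad x \<and> b' \<in> bad x \<and> 2 * w = b + b')}" for x
  define E' where "E' = {x @ [y] | x y. length x = m \<and> (\<exists>w. w \<in> rep x \<and> x @ [w, y] \<in> E)}"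
  have finF: "finite (F x u)" if "length x = m" for x u
    using Suc.prems(2)[of "x @ [u]"] that by (simp add: F_def)
  have finbad: "finite (bad x)" if "length x = m" for x
    using finite_not_locally_matched[OF Suc.prems(1)] finF[OF that] by (simp add: bad_def F_def)
  have finrep: "finite (rep x)" if "length x = m" for x
  proof -
    have "rep x \<subseteq> insert 0 (bad x \<union> (\<lambda>b. b + 1) ` bad x \<union> (\<lambda>b. b - 1) ` bad x \<union>
        (\<lambda>(b, b'). (b + b') / 2) ` (bad x \<times> bad x))"
      unfolding rep_def by (force simp: image_iff)
    then show ?thesis using finbad[OF that] by (auto intro: finite_subset)
  qed
  have "E' \<in> D (Suc m)"
    unfolding E'_def rep_def bad_def F_def mem_Collect_eq
    by (intro D_I_snoc dfn_intros dfn_locally_matched[OF Suc.prems(1)] dfn_mem[OF Suc.prems(1)])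
  moreover have E'_fib: "{y. x @ [y] \<in> E'} = (\<Union>w\<in>rep x. F x w)" if "length x = m" for x
    using that by (auto simp: E'_def F_def)
  then have E'_fin: "finite {y. x @ [y] \<in> E'}" if "length x = m" for x
    using that finF finrep by simp
  ultimately obtain K where K: "\<And>x. length x = m \<Longrightarrow> card {y. x @ [y] \<in> E'} \<le> K"
    using Suc.IH[of E'] by blast
  have "card (F x u) \<le> K" if x: "length x = m" for x u
  proof -
    have "\<exists>w\<in>rep x. card (F x u) = card (F x w)"
    proof -
      define L where "L = {b \<in> bad x. b < u}"
      define U where "U = {b \<in> bad x. u < b}"
      have fin: "finite L" "finite U" using finbad[OF x] by (auto simp: L_def U_def)
      have gap: "\<exists>w\<in>rep x. \<forall>v\<in>{min u w..max u w}. v \<notin> bad x" if "u \<notin> bad x"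
      proof -
        have lu: "v \<in> L \<or> v \<in> U" if "v \<in> bad x" for v
          using that \<open>u \<notin> bad x\<close> by (cases "v = u") (auto simp: L_def U_def)
        have L: "Max L \<in> bad x" "Max L < u" "\<And>v. v \<in> L \<Longrightarrow> v \<le> Max L" if "L \<noteq> {}"
          using Max_in[OF fin(1) that] Max_ge[OF fin(1)] by (auto simp: L_def)
        have U: "Min U \<in> bad x" "u < Min U" "\<And>v. v \<in> U \<Longrightarrow> Min U \<le> v" if "U \<noteq> {}"
          using Min_in[OF fin(2) that] Min_le[OF fin(2)] by (auto simp: U_def)
        show ?thesis
        proof (cases "L = {}"; cases "U = {}")
          assume "L = {}" "U = {}"
          then have "bad x = {}" using lu by blast
          then show ?thesis by (intro bexI[of _ 0]) (auto simp: rep_def)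
        next
          assume *: "L = {}" "U \<noteq> {}"
          show ?thesis
          proof (intro bexI[of _ "Min U - 1"] ballI notI)
            fix v assume v: "v \<in> {min u (Min U - 1)..max u (Min U - 1)}" "v \<in> bad x"
            have "Min U \<le> v" using lu[OF v(2)] U(3)[OF *(2)] * by blast
            then show False
              using v(1) U(2)[OF *(2)] by (auto simp: min_le_iff_disj le_max_iff_disj)
          qed (use U(1)[OF *(2)] in \<open>auto simp: rep_def\<close>)
        next
          assume *: "L \<noteq> {}" "U = {}"
          show ?thesis
          proof (intro bexI[of _ "Max L + 1"] ballI notI)
            fix v assume v: "v \<in> {min u (Max L + 1)..max u (Max L + 1)}" "v \<in> bad x"
            have "v \<le> Max L" using lu[OF v(2)] L(3)[OF *(1)] * by blast
            then show False
              using v(1) L(2)[OF *(1)] by (auto simp: min_le_iff_disj le_max_iff_disj)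
          qed (use L(1)[OF *(1)] in \<open>auto simp: rep_def\<close>)
        next
          assume *: "L \<noteq> {}" "U \<noteq> {}"
          show ?thesis
          proof (intro bexI[of _ "(Max L + Min U) / 2"] ballI notI)
            fix v assume v: "v \<in> {min u ((Max L + Min U) / 2)..max u ((Max L + Min U) / 2)}" "v \<in> bad x"
            have "v \<le> Max L \<or> Min U \<le> v" using lu[OF v(2)] L(3)[OF *(1)] U(3)[OF *(2)] by blast
            then show False
              using v(1) L(2)[OF *(1)] U(2)[OF *(2)] by (auto simp: min_le_iff_disj le_max_iff_disj)
          qed (use L(1)[OF *(1)] U(1)[OF *(2)] in \<open>force simp: rep_def\<close>)
        qed
      qed
      show ?thesis
      proof (cases "u \<in> bad x")
        case True
        then have "u \<in> rep x" by (auto simp: rep_def)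
        then show ?thesis by blast
      next
        case False
        then obtain w where "w \<in> rep x" "\<forall>v\<in>{min u w..max u w}. v \<notin> bad x"
          using gap by blast
        then show ?thesis
          using card_eq_if_locally_matched[of u w "F x"] by (auto simp only: bad_def mem_Collect_eq)
      qed
    qed
    then obtain w where w: "w \<in> rep x" "card (F x u) = card (F x w)" by blast
    have "card (F x w) \<le> card {y. x @ [y] \<in> E'}"
      using w(1) E'_fin[OF x] by (intro card_mono) (auto simp: E'_fib[OF x])
    then show ?thesis using w(2) K[OF x] by simp
  qed
  then have "card {y. x @ [y] \<in> E} \<le> K" if "length x = Suc m" for x
    using that by (cases x rule: rev_cases) (auto simp: F_def)
  then show ?case by blast
qed

end

section \<open>Covering by cells with boundedly many parameters\<close>

text \<open>Ranks are counted from the top through the next larger element, so that for each fixed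
  \<open>j\<close> the condition is a first-order formula.\<close>

primrec nth_greatest :: "real set \<Rightarrow> nat \<Rightarrow> real \<Rightarrow> bool" where
  "nth_greatest Y 0 y \<longleftrightarrow> y \<in> Y \<and> (\<forall>z. z \<in> Y \<longrightarrow> z \<le> y)"
| "nth_greatest Y (Suc j) y \<longleftrightarrow>
    y \<in> Y \<and> (\<exists>z. nth_greatest Y j z \<and> y < z \<and> (\<forall>w. w \<in> Y \<longrightarrow> w \<le> y \<or> z \<le> w))"

lemma nth_greatest_unique: "nth_greatest Y j y \<Longrightarrow> nth_greatest Y j y' \<Longrightarrow> y = y'"
proof (induction j arbitrary: y y')
  case 0
  then show ?case by (auto intro: antisym)
next
  case (Suc j)
  then obtain z z' where z: "nth_greatest Y j z" "y < z" "\<forall>w. w \<in> Y \<longrightarrow> w \<le> y \<or> z \<le> w"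
      "nth_greatest Y j z'" "y' < z'" "\<forall>w. w \<in> Y \<longrightarrow> w \<le> y' \<or> z' \<le> w" "y \<in> Y" "y' \<in> Y"
    by auto
  then have "z = z'" using Suc.IH by blast
  then show ?case using z by force
qed

text \<open>The rank of \<open>y\<close> is the number of elements above it; it drops by one on
  passing to the next larger element \<open>Min U\<close>.\<close>

lemma nth_greatest_exists:
  assumes "finite Y" "y \<in> Y"
  obtains j where "j < card Y" "nth_greatest Y j y"
proof -
  have "nth_greatest Y k y" if "k = card {z \<in> Y. y < z}" "y \<in> Y" for k y
    using that
  proof (induction k arbitrary: y)
    case 0
    then have "{z \<in> Y. y < z} = {}" using \<open>finite Y\<close> by simp
    then show ?case using 0 by (auto simp: not_less)
  next
    case (Suc k)
    define U where "U = {z \<in> Y. y < z}"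
    have "card U = Suc k" using Suc.prems by (simp add: U_def)
    then have U: "finite U" "U \<noteq> {}" by (auto intro: card_ge_0_finite)
    have z: "Min U \<in> Y" "y < Min U" using Min_in[OF U] by (auto simp: U_def)
    have le: "w \<le> y \<or> Min U \<le> w" if "w \<in> Y" for w
      using that Min_le[OF U(1), of w] by (cases "y < w") (auto simp: U_def)
    have "{w \<in> Y. Min U < w} = U - {Min U}"
      using le z by (force simp: U_def)
    then have "k = card {w \<in> Y. Min U < w}"
      using Suc.prems U Min_in[OF U] by (simp add: U_def[symmetric])
    then have "nth_greatest Y k (Min U)" using Suc.IH z(1) by blast
    then show ?case unfolding nth_greatest.simps using Suc.prems(2) z le by blast
  qed
  moreover have "card {z \<in> Y. y < z} < card Y"
    using assms by (intro psubset_card_mono) auto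
  ultimately show thesis using that assms(2) by blast
qed

context o_minimal
begin

lemma dfn_nth_greatest:
  assumes "E \<in> D n" "dfn_list v" "dfn_term t"
  shows "dfn (\<lambda>e. nth_greatest {y. v e @ [y] \<in> E} j (t e))"
  using assms(2,3)
proof (induction j arbitrary: v t)
  case 0
  then show ?case
    unfolding nth_greatest.simps mem_Collect_eq
    by (intro dfn_intros dfn_mem[OF assms(1)] dfn_list_reindex[OF 0(1)] dfn_term_reindex[OF 0(2)])
next
  case (Suc j)
  show ?case
    unfolding nth_greatest.simps mem_Collect_eq
    by (intro dfn_intros dfn_mem[OF assms(1)] Suc.IH dfn_list_reindex[OF Suc.prems(1)]
        dfn_term_reindex[OF Suc.prems(2)])
qed

lemma D_frontier:
  assumes C: "C \<in> D (Suc m)"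
  shows "{z @ [y] | z y. length z = m \<and> y \<in> frontier {y. z @ [y] \<in> C}} \<in> D (Suc m)"
  unfolding frontier_straddle Bex_def mem_Collect_eq dist_real_def
  by (intro D_I_snoc dfn_intros dfn_mem[OF C])

text \<open>The neighbours of \<open>y\<close> among the boundary points of all fibres may come from
  two different parameters, hence \<open>a1\<close> and \<open>a2\<close>. Each neighbour is named
  by its rank within the fibre of its own parameter, and this rank is below the uniform bound
  \<open>K\<close>; so finitely many shapes suffice whatever the size of \<open>A\<close>.\<close>

lemma section_cover:
  assumes C: "C \<in> D (r + p + Suc q)"
  obtains R where "finite R" "R \<subseteq> D (r + p + p + Suc q)"
    "\<And>c A x y. length c = r \<Longrightarrow> finite A \<Longrightarrow> A \<noteq> {} \<Longrightarrow> A \<subseteq> Rn p \<Longrightarrow> length x = q \<Longrightarrow>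
      \<exists>\<rho>\<in>R. \<exists>a1\<in>A. \<exists>a2\<in>A. c @ a1 @ a2 @ x @ [y] \<in> \<rho> \<and>
        (\<forall>a\<in>A. \<forall>y'. c @ a1 @ a2 @ x @ [y'] \<in> \<rho> \<longrightarrow> (c @ a @ x @ [y'] \<in> C \<longleftrightarrow> c @ a @ x @ [y] \<in> C))"
proof -
  define B where "B = {z @ [y] | z y. length z = r + p + q \<and> y \<in> frontier {y. z @ [y] \<in> C}}"
  define bd where "bd = (\<lambda>z. {y. z @ [y] \<in> B})"
  have B: "B \<in> D (Suc (r + p + q))" using D_frontier[of C "r + p + q"] C by (simp add: B_def)
  have bd: "bd z = frontier {y. z @ [y] \<in> C}" if "length z = r + p + q" for z
    using that by (auto simp: bd_def B_def)
  have bd_finite: "finite (bd z)" if "length z = r + p + q" for z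
    unfolding bd[OF that] by (intro dfn_finite_frontier dfn_mem[OF C] dfn_intros)
  then obtain K where K: "\<And>z. length z = r + p + q \<Longrightarrow> card (bd z) \<le> K"
    using uniform_finiteness[OF B] by (auto simp: bd_def)
  define mk where "mk P = {zs. length zs = r + p + p + Suc q \<and>
    (\<exists>c. length c = r \<and> (\<exists>a1. length a1 = p \<and> (\<exists>a2. length a2 = p \<and> (\<exists>x. length x = q \<and>
      (\<exists>y. zs = c @ a1 @ a2 @ x @ [y] \<and> P (c @ a1 @ x) (c @ a2 @ x) y)))))}" for P :: "real list \<Rightarrow> real list \<Rightarrow> real \<Rightarrow> bool"
  have mk: "c @ a1 @ a2 @ x @ [y] \<in> mk P \<longleftrightarrow> P (c @ a1 @ x) (c @ a2 @ x) y"
    if "length c = r" "length a1 = p" "length a2 = p" "length x = q" for P c a1 a2 x y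
  proof
    assume "c @ a1 @ a2 @ x @ [y] \<in> mk P"
    then obtain c' a1' a2' x' y' where "length c' = r" "length a1' = p" "length a2' = p" "length x' = q"
        "c @ a1 @ a2 @ x @ [y] = c' @ a1' @ a2' @ x' @ [y']" "P (c' @ a1' @ x') (c' @ a2' @ x') y'"
      unfolding mk_def by blast
    then show "P (c @ a1 @ x) (c @ a2 @ x) y" using that by simp
  next
    assume "P (c @ a1 @ x) (c @ a2 @ x) y"
    moreover have "length (c @ a1 @ a2 @ x @ [y]) = r + p + p + Suc q" using that by simp
    ultimately show "c @ a1 @ a2 @ x @ [y] \<in> mk P" unfolding mk_def using that by blast
  qed
  \<comment> \<open>\<open>None\<close> means that no boundary point lies on this side.\<close>
  define lower where "lower lo z y \<longleftrightarrow>
    (case lo of None \<Rightarrow> True | Some j \<Rightarrow> (\<exists>u. nth_greatest (bd z) j u \<and> u < y))" for lo z y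
  define upper where "upper up z y \<longleftrightarrow>
    (case up of None \<Rightarrow> True | Some j \<Rightarrow> (\<exists>u. nth_greatest (bd z) j u \<and> y < u))" for up z y
  define opts where "opts = insert None (Some ` {..<K})"
  \<comment> \<open>The first group consists of boundary points, taken with \<open>a1 = a2\<close>
    below; the second of the open intervals between them, possibly unbounded.\<close>
  define R where "R = (\<lambda>j. mk (\<lambda>z z'. nth_greatest (bd z) j)) ` {..<K} \<union>
    (\<lambda>(lo, up). mk (\<lambda>z z' y. lower lo z y \<and> upper up z' y)) ` (opts \<times> opts)"
  show thesis
  proof
    show "finite R" by (simp add: R_def opts_def)
    have "mk (\<lambda>z z'. nth_greatest (bd z) j) \<in> D (r + p + p + Suc q)" for j
      unfolding mk_def bd_def
      by (intro D_I dfn_intros dfn_nth_greatest[OF B])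
    moreover have "mk (\<lambda>z z' y. lower lo z y \<and> upper up z' y) \<in> D (r + p + p + Suc q)" for lo up
      unfolding mk_def lower_def upper_def bd_def
      by (cases lo; cases up; simp only: option.case)
        (intro D_I dfn_intros dfn_nth_greatest[OF B] dfn_constant)+
    ultimately show "R \<subseteq> D (r + p + p + Suc q)" by (auto simp: R_def)
  next
    fix c x :: "real list" and A y
    assume c: "length c = r" and A: "finite A" "A \<noteq> {}" "A \<subseteq> Rn p" and x: "length x = q"
    have Ap: "length a = p" if "a \<in> A" for a using A(3) that by (auto simp: Rn_def)
    define BB where "BB = (\<Union>a\<in>A. bd (c @ a @ x))"
    have BB: "finite BB" unfolding BB_def using A(1) bd_finite Ap c x by auto
    have rank: "\<exists>a\<in>A. \<exists>j<K. nth_greatest (bd (c @ a @ x)) j b" if "b \<in> BB" for b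
    proof -
      from that obtain a where a: "a \<in> A" "b \<in> bd (c @ a @ x)" by (auto simp: BB_def)
      have "length (c @ a @ x) = r + p + q" using Ap a c x by simp
      then obtain j where "j < card (bd (c @ a @ x))" "nth_greatest (bd (c @ a @ x)) j b"
        using nth_greatest_exists[OF bd_finite] a(2) by blast
      then show ?thesis using K[OF \<open>length (c @ a @ x) = r + p + q\<close>] a(1) by force
    qed
    show "\<exists>\<rho>\<in>R. \<exists>a1\<in>A. \<exists>a2\<in>A. c @ a1 @ a2 @ x @ [y] \<in> \<rho> \<and>
        (\<forall>a\<in>A. \<forall>y'. c @ a1 @ a2 @ x @ [y'] \<in> \<rho> \<longrightarrow> (c @ a @ x @ [y'] \<in> C \<longleftrightarrow> c @ a @ x @ [y] \<in> C))"
    proof (cases "y \<in> BB")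
      case True
      then obtain a j where aj: "a \<in> A" "j < K" "nth_greatest (bd (c @ a @ x)) j y" using rank by blast
      let ?\<rho> = "mk (\<lambda>z z'. nth_greatest (bd z) j)"
      have "?\<rho> \<in> R" using aj by (auto simp: R_def)
      moreover have "c @ a @ a @ x @ [y] \<in> ?\<rho>" "\<And>y'. c @ a @ a @ x @ [y'] \<in> ?\<rho> \<Longrightarrow> y' = y"
        using aj mk[OF c Ap Ap x] nth_greatest_unique by auto
      ultimately show ?thesis using aj(1) by blast
    next
      case False
      have "\<exists>lo\<in>opts. \<exists>a\<in>A. lower lo (c @ a @ x) y \<and>
          (\<forall>y'. lower lo (c @ a @ x) y' \<longrightarrow> (\<forall>b\<in>BB. b < y \<longrightarrow> b < y'))"
      proof (cases "{b \<in> BB. b < y} = {}")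
        case True
        then show ?thesis using A(2) by (intro bexI[of _ None]) (auto simp: opts_def lower_def)
      next
        case False
        define u where "u = Max {b \<in> BB. b < y}"
        have u: "u \<in> BB" "u < y" "\<And>b. b \<in> BB \<Longrightarrow> b < y \<Longrightarrow> b \<le> u"
          using Max_in[OF _ False] BB by (auto simp: u_def)
        from rank[OF u(1)] obtain a j where aj: "a \<in> A" "j < K" "nth_greatest (bd (c @ a @ x)) j u" by blast
        have "lower (Some j) (c @ a @ x) y' \<longleftrightarrow> u < y'" for y'
          unfolding lower_def option.case using aj(3) nth_greatest_unique by metis
        then show ?thesis
          using aj u by (intro bexI[of _ "Some j"] bexI[of _ a]) (auto simp: opts_def intro: le_less_trans)
      qed
      then obtain lo a1 where lo: "lo \<in> opts" "a1 \<in> A" "lower lo (c @ a1 @ x) y"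
          "\<And>y' b. lower lo (c @ a1 @ x) y' \<Longrightarrow> b \<in> BB \<Longrightarrow> b < y \<Longrightarrow> b < y'"
        by blast
      have "\<exists>up\<in>opts. \<exists>a\<in>A. upper up (c @ a @ x) y \<and>
          (\<forall>y'. upper up (c @ a @ x) y' \<longrightarrow> (\<forall>b\<in>BB. y < b \<longrightarrow> y' < b))"
      proof (cases "{b \<in> BB. y < b} = {}")
        case True
        then show ?thesis using A(2) by (intro bexI[of _ None]) (auto simp: opts_def upper_def)
      next
        case False
        define u where "u = Min {b \<in> BB. y < b}"
        have u: "u \<in> BB" "y < u" "\<And>b. b \<in> BB \<Longrightarrow> y < b \<Longrightarrow> u \<le> b"
          using Min_in[OF _ False] BB by (auto simp: u_def)
        from rank[OF u(1)] obtain a j where aj: "a \<in> A" "j < K" "nth_greatest (bd (c @ a @ x)) j u" by blast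
        have "upper (Some j) (c @ a @ x) y' \<longleftrightarrow> y' < u" for y'
          unfolding upper_def option.case using aj(3) nth_greatest_unique by metis
        then show ?thesis
          using aj u by (intro bexI[of _ "Some j"] bexI[of _ a]) (auto simp: opts_def intro: less_le_trans)
      qed
      then obtain up a2 where up: "up \<in> opts" "a2 \<in> A" "upper up (c @ a2 @ x) y"
          "\<And>y' b. upper up (c @ a2 @ x) y' \<Longrightarrow> b \<in> BB \<Longrightarrow> y < b \<Longrightarrow> y' < b"
        by blast
      let ?\<rho> = "mk (\<lambda>z z' y. lower lo z y \<and> upper up z' y)"
      note \<rho> = mk[OF c Ap[OF lo(2)] Ap[OF up(2)] x]
      have "c @ a @ x @ [y'] \<in> C \<longleftrightarrow> c @ a @ x @ [y] \<in> C"
        if a: "a \<in> A" and y': "c @ a1 @ a2 @ x @ [y'] \<in> ?\<rho>" for a y'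
      proof (rule ccontr)
        assume neq: "\<not> ?thesis"
        let ?X = "{y. (c @ a @ x) @ [y] \<in> C}"
        let ?W = "{min y y'..max y y'}"
        have "y \<in> ?W" "y' \<in> ?W" "y \<in> ?X \<longleftrightarrow> y' \<notin> ?X" using neq by auto
        \<comment> \<open>A change of membership between \<open>y\<close> and \<open>y'\<close>
          would put a boundary point between them, but none lies strictly inside the piece on either
          side of \<open>y\<close>, and \<open>y\<close> itself is not one.\<close>
        then have "connected ?W" "?W \<inter> ?X \<noteq> {}" "?W - ?X \<noteq> {}" by (simp, blast, blast)
        from connected_Int_frontier[OF this] obtain b where b: "b \<in> ?W" "b \<in> frontier ?X" by blast
        then have "b \<in> BB" using bd[of "c @ a @ x"] Ap[OF a] a c x by (auto simp: BB_def)
        moreover have "b \<noteq> y" using False \<open>b \<in> BB\<close> by auto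
        ultimately show False
          using lo(4)[of y' b] up(4)[of y' b] y' b(1) unfolding \<rho> by (auto simp: min_def max_def split: if_splits)
      qed
      moreover have "?\<rho> \<in> R" using lo(1) up(1) by (force simp: R_def)
      moreover have "c @ a1 @ a2 @ x @ [y] \<in> ?\<rho>" using lo up unfolding \<rho> by blast
      ultimately show ?thesis using lo(2) up(2) by blast
    qed
  qed
qed

text \<open>A pair \<open>(k, \<psi>)\<close> is a definable family of cells with parameters \<open>c\<close> and a
  \<open>k\<close>-tuple of parameters of the family \<open>C\<close>.\<close>

definition cell_cover :: "nat \<Rightarrow> nat \<Rightarrow> nat \<Rightarrow> real list set \<Rightarrow> (nat \<times> real list set) set \<Rightarrow> bool" where
  "cell_cover r p q C \<Psi> \<longleftrightarrow> finite \<Psi> \<and> (\<forall>(k, \<psi>)\<in>\<Psi>. \<psi> \<in> D (r + k * p + q)) \<and>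
    (\<forall>c A x. length c = r \<longrightarrow> finite A \<longrightarrow> A \<noteq> {} \<longrightarrow> A \<subseteq> Rn p \<longrightarrow> length x = q \<longrightarrow>
      (\<exists>(k, \<psi>)\<in>\<Psi>. \<exists>as. length as = k \<and> set as \<subseteq> A \<and> c @ concat as @ x \<in> \<psi> \<and>
        (\<forall>a\<in>A. \<forall>x'. length x' = q \<longrightarrow> c @ concat as @ x' \<in> \<psi> \<longrightarrow> (c @ a @ x' \<in> C \<longleftrightarrow> c @ a @ x \<in> C))))"

lemma cell_coverD:
  assumes "cell_cover r p q C \<Psi>" "length c = r" "finite A" "A \<noteq> {}" "A \<subseteq> Rn p" "length x = q"
  obtains k \<psi> as where "(k, \<psi>) \<in> \<Psi>" "\<psi> \<in> D (r + k * p + q)" "length as = k" "set as \<subseteq> A"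
    "c @ concat as @ x \<in> \<psi>"
    "\<And>a x'. a \<in> A \<Longrightarrow> length x' = q \<Longrightarrow> c @ concat as @ x' \<in> \<psi> \<Longrightarrow> c @ a @ x' \<in> C \<longleftrightarrow> c @ a @ x \<in> C"
proof -
  have "\<exists>(k, \<psi>)\<in>\<Psi>. \<exists>as. length as = k \<and> set as \<subseteq> A \<and> c @ concat as @ x \<in> \<psi> \<and>
      (\<forall>a\<in>A. \<forall>x'. length x' = q \<longrightarrow> c @ concat as @ x' \<in> \<psi> \<longrightarrow> (c @ a @ x' \<in> C \<longleftrightarrow> c @ a @ x \<in> C))"
    using assms(1)[unfolded cell_cover_def, THEN conjunct2, THEN conjunct2] assms(2-) by simp
  then obtain k \<psi> as where *: "(k, \<psi>) \<in> \<Psi>" "length as = k" "set as \<subseteq> A" "c @ concat as @ x \<in> \<psi>"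
      "\<forall>a\<in>A. \<forall>x'. length x' = q \<longrightarrow> c @ concat as @ x' \<in> \<psi> \<longrightarrow> (c @ a @ x' \<in> C \<longleftrightarrow> c @ a @ x \<in> C)"
    by blast
  moreover have "\<psi> \<in> D (r + k * p + q)" using assms(1) *(1) by (auto simp: cell_cover_def)
  ultimately show thesis using that[of k \<psi> as] by simp
qed

lemma length_concat_Rn: "set as \<subseteq> Rn p \<Longrightarrow> length (concat as) = length as * p"
  by (induction as) (auto simp: Rn_def)

text \<open>Induction removes the last coordinate. The parameters \<open>a1\<close> and
  \<open>a2\<close> of the piece over the base join the fixed parameters \<open>c\<close>, which is
  why \<open>r\<close> and \<open>C\<close> vary in the induction.\<close>

theorem cell_cover_exists: "C \<in> D (r + p + q) \<Longrightarrow> \<exists>\<Psi>. cell_cover r p q C \<Psi>"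
proof (induction q arbitrary: r C)
  case 0
  \<comment> \<open>In dimension 0 both compared points are the empty list, so one cell without
    parameters is enough.\<close>
  have "cell_cover r p 0 C {(0, Rn r)}"
    using D_Rn[of r] by (auto simp: cell_cover_def Rn_def)
  then show ?case ..
next
  case (Suc q)
  obtain R where R: "finite R" "R \<subseteq> D (r + p + p + Suc q)"
    "\<And>c A x y. length c = r \<Longrightarrow> finite A \<Longrightarrow> A \<noteq> {} \<Longrightarrow> A \<subseteq> Rn p \<Longrightarrow> length x = q \<Longrightarrow>
      \<exists>\<rho>\<in>R. \<exists>a1\<in>A. \<exists>a2\<in>A. c @ a1 @ a2 @ x @ [y] \<in> \<rho> \<and>
        (\<forall>a\<in>A. \<forall>y'. c @ a1 @ a2 @ x @ [y'] \<in> \<rho> \<longrightarrow> (c @ a @ x @ [y'] \<in> C \<longleftrightarrow> c @ a @ x @ [y] \<in> C))"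
    using section_cover[OF Suc.prems] by blast
  \<comment> \<open>\<open>\<Phi> b \<rho>\<close> is a condition on the base: the whole piece
    \<open>\<rho>\<close> has truth value \<open>b\<close> for membership in the fibre of
    \<open>a\<close>. Both values of \<open>b\<close> need their own cover, because over another
    base point the piece may be mixed, so failure of one condition does not give the other.\<close>
  define \<Phi> where "\<Phi> b \<rho> = {zs. length zs = r + p + p + p + q \<and>
    (\<exists>c. length c = r \<and> (\<exists>a1. length a1 = p \<and> (\<exists>a2. length a2 = p \<and> (\<exists>a. length a = p \<and> (\<exists>x. length x = q \<and>
      zs = c @ a1 @ a2 @ a @ x \<and> (\<forall>y. c @ a1 @ a2 @ x @ [y] \<in> \<rho> \<longrightarrow> ((c @ a @ x @ [y] \<in> C) = b)))))))}" for b \<rho>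
  have \<Phi>: "(c @ a1 @ a2) @ a @ x \<in> \<Phi> b \<rho> \<longleftrightarrow>
      (\<forall>y. c @ a1 @ a2 @ x @ [y] \<in> \<rho> \<longrightarrow> ((c @ a @ x @ [y] \<in> C) = b))"
    if "length c = r" "length a1 = p" "length a2 = p" "length a = p" "length x = q" for c a1 a2 a x b \<rho>
  proof
    assume "(c @ a1 @ a2) @ a @ x \<in> \<Phi> b \<rho>"
    then obtain c' a1' a2' a' x' where "length c' = r" "length a1' = p" "length a2' = p" "length a' = p" "length x' = q"
        "(c @ a1 @ a2) @ a @ x = c' @ a1' @ a2' @ a' @ x'"
        "\<forall>y. c' @ a1' @ a2' @ x' @ [y] \<in> \<rho> \<longrightarrow> ((c' @ a' @ x' @ [y] \<in> C) = b)"
      unfolding \<Phi>_def by blast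
    then show "\<forall>y. c @ a1 @ a2 @ x @ [y] \<in> \<rho> \<longrightarrow> ((c @ a @ x @ [y] \<in> C) = b)" using that by simp
  next
    assume "\<forall>y. c @ a1 @ a2 @ x @ [y] \<in> \<rho> \<longrightarrow> ((c @ a @ x @ [y] \<in> C) = b)"
    moreover have "length (c @ a1 @ a2 @ a @ x) = r + p + p + p + q" using that by simp
    ultimately show "(c @ a1 @ a2) @ a @ x \<in> \<Phi> b \<rho>" unfolding \<Phi>_def append_assoc using that by blast
  qed
  have "\<Phi> b \<rho> \<in> D (r + p + p + p + q)" if "\<rho> \<in> R" for b \<rho>
    unfolding \<Phi>_def
    using that R(2) by (intro D_I dfn_intros dfn_mem[OF Suc.prems] dfn_mem[of \<rho>] dfn_constant) auto
  then have "\<exists>\<Psi>. cell_cover (r + p + p) p q (\<Phi> b \<rho>) \<Psi>" if "\<rho> \<in> R" for b \<rho>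
    using that Suc.IH by simp
  then have ex: "\<forall>b. \<forall>\<rho>\<in>R. \<exists>\<Psi>. cell_cover (r + p + p) p q (\<Phi> b \<rho>) \<Psi>" by blast
  define \<Psi> where "\<Psi> b \<rho> = (SOME \<Psi>. cell_cover (r + p + p) p q (\<Phi> b \<rho>) \<Psi>)" for b \<rho>
  have \<Psi>: "cell_cover (r + p + p) p q (\<Phi> b \<rho>) (\<Psi> b \<rho>)" if "\<rho> \<in> R" for b \<rho>
    unfolding \<Psi>_def by (rule someI_ex) (use ex that in blast)
  \<comment> \<open>The part of \<open>\<rho>\<close> lying over a common base cell of both covers.
    Its parameters are \<open>a1\<close>, \<open>a2\<close> and the tuples of the two covers,
    \<open>2 + k + k'\<close> in all.\<close>
  define cell where "cell \<rho> k \<psi> k' \<psi>' = {zs. length zs = r + (2 + k + k') * p + Suc q \<and>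
    (\<exists>c. length c = r \<and> (\<exists>a1. length a1 = p \<and> (\<exists>a2. length a2 = p \<and>
      (\<exists>as. length as = k * p \<and> (\<exists>as'. length as' = k' * p \<and> (\<exists>x. length x = q \<and> (\<exists>y.
        zs = c @ a1 @ a2 @ as @ as' @ x @ [y] \<and> c @ a1 @ a2 @ as @ x \<in> \<psi> \<and> c @ a1 @ a2 @ as' @ x \<in> \<psi>' \<and>
        c @ a1 @ a2 @ x @ [y] \<in> \<rho>)))))))}" for \<rho> \<psi> \<psi>' :: "real list set" and k k'
  have cell: "c @ a1 @ a2 @ as @ as' @ x @ [y] \<in> cell \<rho> k \<psi> k' \<psi>' \<longleftrightarrow>
      c @ a1 @ a2 @ as @ x \<in> \<psi> \<and> c @ a1 @ a2 @ as' @ x \<in> \<psi>' \<and> c @ a1 @ a2 @ x @ [y] \<in> \<rho>"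
    if "length c = r" "length a1 = p" "length a2 = p" "length as = k * p" "length as' = k' * p" "length x = q"
    for c a1 a2 as as' x y \<rho> k \<psi> k' \<psi>'
  proof
    assume "c @ a1 @ a2 @ as @ as' @ x @ [y] \<in> cell \<rho> k \<psi> k' \<psi>'"
    then obtain d b1 b2 bs bs' x' y' where "length d = r" "length b1 = p" "length b2 = p" "length bs = k * p"
        "length bs' = k' * p" "length x' = q" "c @ a1 @ a2 @ as @ as' @ x @ [y] = d @ b1 @ b2 @ bs @ bs' @ x' @ [y']"
        "d @ b1 @ b2 @ bs @ x' \<in> \<psi>" "d @ b1 @ b2 @ bs' @ x' \<in> \<psi>'" "d @ b1 @ b2 @ x' @ [y'] \<in> \<rho>"
      unfolding cell_def by blast
    then show "c @ a1 @ a2 @ as @ x \<in> \<psi> \<and> c @ a1 @ a2 @ as' @ x \<in> \<psi>' \<and> c @ a1 @ a2 @ x @ [y] \<in> \<rho>"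
      using that by simp
  next
    assume "c @ a1 @ a2 @ as @ x \<in> \<psi> \<and> c @ a1 @ a2 @ as' @ x \<in> \<psi>' \<and> c @ a1 @ a2 @ x @ [y] \<in> \<rho>"
    moreover have "length (c @ a1 @ a2 @ as @ as' @ x @ [y]) = r + (2 + k + k') * p + Suc q"
      using that by (simp add: algebra_simps)
    ultimately show "c @ a1 @ a2 @ as @ as' @ x @ [y] \<in> cell \<rho> k \<psi> k' \<psi>'"
      unfolding cell_def using that by blast
  qed
  define \<Psi>' where "\<Psi>' = (\<Union>\<rho>\<in>R. \<Union>(k, \<psi>)\<in>\<Psi> True \<rho>. \<Union>(k', \<psi>')\<in>\<Psi> False \<rho>. {(2 + k + k', cell \<rho> k \<psi> k' \<psi>')})"
  have "cell_cover r p (Suc q) C \<Psi>'"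
    unfolding cell_cover_def
  proof (intro conjI allI impI)
    show "finite \<Psi>'"
      unfolding \<Psi>'_def using R(1) \<Psi> by (auto simp: cell_cover_def)
    show "\<forall>(k, \<psi>)\<in>\<Psi>'. \<psi> \<in> D (r + k * p + Suc q)"
    proof -
      have "cell \<rho> k \<psi> k' \<psi>' \<in> D (r + (2 + k + k') * p + Suc q)"
        if "\<rho> \<in> R" "(k, \<psi>) \<in> \<Psi> True \<rho>" "(k', \<psi>') \<in> \<Psi> False \<rho>" for \<rho> k \<psi> k' \<psi>'
      proof -
        have *: "\<psi> \<in> D (r + p + p + k * p + q)" "\<psi>' \<in> D (r + p + p + k' * p + q)" "\<rho> \<in> D (r + p + p + Suc q)"
          using that \<Psi>[OF that(1)] R(2) by (auto simp: cell_cover_def)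
        show ?thesis
          unfolding cell_def
          by (intro D_I dfn_intros dfn_mem[OF *(1)] dfn_mem[OF *(2)] dfn_mem[OF *(3)])
      qed
      then show ?thesis unfolding \<Psi>'_def by blast
    qed
    fix c x1 :: "real list" and A
    assume c: "length c = r" and A: "finite A" "A \<noteq> {}" "A \<subseteq> Rn p" and x1: "length x1 = Suc q"
    have Ap: "length a = p" if "a \<in> A" for a using A(3) that by (auto simp: Rn_def)
    obtain x y where x: "x1 = x @ [y]" "length x = q"
      using x1 by (cases x1 rule: rev_cases) auto
    obtain \<rho> a1 a2 where \<rho>: "\<rho> \<in> R" "a1 \<in> A" "a2 \<in> A" "c @ a1 @ a2 @ x @ [y] \<in> \<rho>"
      "\<And>a y'. a \<in> A \<Longrightarrow> c @ a1 @ a2 @ x @ [y'] \<in> \<rho> \<Longrightarrow> c @ a @ x @ [y'] \<in> C \<longleftrightarrow> c @ a @ x @ [y] \<in> C"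
      using R(3)[OF c A x(2), of y] by blast
    have l: "length (c @ a1 @ a2) = r + p + p" using c Ap \<rho> by simp
    obtain k \<psi> as where 1: "(k, \<psi>) \<in> \<Psi> True \<rho>" "\<psi> \<in> D (r + p + p + k * p + q)" "length as = k" "set as \<subseteq> A"
      "(c @ a1 @ a2) @ concat as @ x \<in> \<psi>"
      "\<And>a x'. a \<in> A \<Longrightarrow> length x' = q \<Longrightarrow> (c @ a1 @ a2) @ concat as @ x' \<in> \<psi> \<Longrightarrow>
        (c @ a1 @ a2) @ a @ x' \<in> \<Phi> True \<rho> \<longleftrightarrow> (c @ a1 @ a2) @ a @ x \<in> \<Phi> True \<rho>"
      by (rule cell_coverD[OF \<Psi>[OF \<rho>(1)] l A x(2), of True]) (rule that)
    obtain k' \<psi>' as' where 2: "(k', \<psi>') \<in> \<Psi> False \<rho>" "\<psi>' \<in> D (r + p + p + k' * p + q)" "length as' = k'" "set as' \<subseteq> A"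
      "(c @ a1 @ a2) @ concat as' @ x \<in> \<psi>'"
      "\<And>a x'. a \<in> A \<Longrightarrow> length x' = q \<Longrightarrow> (c @ a1 @ a2) @ concat as' @ x' \<in> \<psi>' \<Longrightarrow>
        (c @ a1 @ a2) @ a @ x' \<in> \<Phi> False \<rho> \<longleftrightarrow> (c @ a1 @ a2) @ a @ x \<in> \<Phi> False \<rho>"
      by (rule cell_coverD[OF \<Psi>[OF \<rho>(1)] l A x(2), of False]) (rule that)
    have len: "length (concat as) = k * p" "length (concat as') = k' * p"
      using length_concat_Rn[of as p] length_concat_Rn[of as' p] 1(3,4) 2(3,4) A(3) by auto
    note cell' = cell[OF c Ap[OF \<rho>(2)] Ap[OF \<rho>(3)] len]
    note \<Phi>' = \<Phi>[OF c Ap[OF \<rho>(2)] Ap[OF \<rho>(3)]]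
    define bs where "bs = a1 # a2 # as @ as'"
    have bs: "c @ concat bs @ z = c @ a1 @ a2 @ concat as @ concat as' @ z" for z
      by (simp add: bs_def)
    have "(2 + k + k', cell \<rho> k \<psi> k' \<psi>') \<in> \<Psi>'"
      unfolding \<Psi>'_def using \<rho>(1) 1(1) 2(1) by blast
    moreover have "length bs = 2 + k + k'" "set bs \<subseteq> A"
      using 1 2 \<rho> by (auto simp: bs_def)
    moreover have "c @ concat bs @ x1 \<in> cell \<rho> k \<psi> k' \<psi>'"
      using cell'[OF x(2)] 1(5) 2(5) \<rho>(4) by (simp add: bs x(1))
    moreover have "c @ a @ x1' \<in> C \<longleftrightarrow> c @ a @ x1 \<in> C"
      if a: "a \<in> A" and x1': "length x1' = Suc q" "c @ concat bs @ x1' \<in> cell \<rho> k \<psi> k' \<psi>'" for a x1'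
    proof -
      obtain x' y' where x': "x1' = x' @ [y']" "length x' = q"
        using x1' by (cases x1' rule: rev_cases) auto
      have in': "c @ a1 @ a2 @ concat as @ x' \<in> \<psi>" "c @ a1 @ a2 @ concat as' @ x' \<in> \<psi>'" "c @ a1 @ a2 @ x' @ [y'] \<in> \<rho>"
        using x1'(2) cell'[OF x'(2)] by (auto simp: bs x'(1))
      \<comment> \<open>Of the two covers, the one for the actual truth value at
        \<open>(x, y)\<close> applies to this \<open>a\<close>: it carries homogeneity of the piece
        from \<open>x\<close> to \<open>x'\<close>.\<close>
      define b where "b \<longleftrightarrow> c @ a @ x @ [y] \<in> C"
      have "(c @ a1 @ a2) @ a @ x \<in> \<Phi> b \<rho>"
        unfolding \<Phi>'[OF Ap[OF a] x(2)] b_def using \<rho>(5)[OF a] by blast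
      then have "(c @ a1 @ a2) @ a @ x' \<in> \<Phi> b \<rho>"
        using 1(6)[OF a x'(2)] 2(6)[OF a x'(2)] in' by (cases b) simp_all
      then have "(c @ a @ x' @ [y'] \<in> C) = b"
        unfolding \<Phi>'[OF Ap[OF a] x'(2)] using in'(3) by blast
      then show ?thesis by (simp add: x(1) x'(1) b_def)
    qed
    ultimately show "\<exists>(k, \<psi>)\<in>\<Psi>'. \<exists>as. length as = k \<and> set as \<subseteq> A \<and> c @ concat as @ x1 \<in> \<psi> \<and>
        (\<forall>a\<in>A. \<forall>x'. length x' = Suc q \<longrightarrow> c @ concat as @ x' \<in> \<psi> \<longrightarrow> (c @ a @ x' \<in> C \<longleftrightarrow> c @ a @ x1 \<in> C))"
      by (intro bexI[of _ "(2 + k + k', cell \<rho> k \<psi> k' \<psi>')"]) blast+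
  qed
  then show ?case ..
qed

end

section \<open>A uniform exponent for one-parameter families\<close>

context o_minimal
begin

text \<open>A definable choice of \<open>v\<close> is replaced by the infimum of the admissible
  values, a definable function of \<open>s\<close> to which polynomial boundedness applies.\<close>

lemma polynomially_bounded_selection:
  assumes pb: "polynomially_bounded D" and P: "dfn (\<lambda>e. P (e 0) (e 1))"
    and ex: "\<And>s. s > s1 \<Longrightarrow> \<exists>v\<ge>1. P s v"
  obtains N :: nat and c :: real where "\<And>s. s > c \<Longrightarrow> \<exists>v\<ge>1. P s v \<and> v < s ^ N"
proof -
  \<comment> \<open>The infimum need not be attained; adding 1 ensures that some witness lies below
    \<open>h s\<close>.\<close>
  define h where "h s = (if s > s1 then Inf {v. 1 \<le> v \<and> P s v} + 1 else 0)" for s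
  have ne: "{v. 1 \<le> v \<and> P s v} \<noteq> {}" if "s > s1" for s using ex[OF that] by blast
  have bdd: "bdd_below {v. 1 \<le> v \<and> P s v}" for s by (rule bdd_belowI[of _ 1]) simp
  \<comment> \<open>The infimum is spelled out as greatest lower bound, which is a formula in
    \<open>P\<close>.\<close>
  have h: "h s = y \<longleftrightarrow> (s1 < s \<and> (\<forall>v. 1 \<le> v \<and> P s v \<longrightarrow> y - 1 \<le> v) \<and>
      (\<forall>w. (\<forall>v. 1 \<le> v \<and> P s v \<longrightarrow> w \<le> v) \<longrightarrow> w \<le> y - 1)) \<or> (s \<le> s1 \<and> y = 0)" for s y
  proof (cases "s > s1")
    case True
    let ?I = "Inf {v. 1 \<le> v \<and> P s v}"
    have 1: "\<And>v. 1 \<le> v \<and> P s v \<Longrightarrow> ?I \<le> v" using cInf_lower[OF _ bdd] by blast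
    have 2: "\<And>w. (\<And>v. 1 \<le> v \<and> P s v \<Longrightarrow> w \<le> v) \<Longrightarrow> w \<le> ?I" using cInf_greatest[OF ne[OF True]] by blast
    have "?I + 1 = y \<longleftrightarrow> (\<forall>v. 1 \<le> v \<and> P s v \<longrightarrow> y - 1 \<le> v) \<and>
      (\<forall>w. (\<forall>v. 1 \<le> v \<and> P s v \<longrightarrow> w \<le> v) \<longrightarrow> w \<le> y - 1)" (is "?l \<longleftrightarrow> ?a \<and> ?b")
    proof
      assume ?l
      then have "y - 1 = ?I" by simp
      then show "?a \<and> ?b" using 1 2 by metis
    next
      assume *: "?a \<and> ?b"
      then have "y - 1 \<le> ?I" using 2 by blast
      moreover have "?I \<le> y - 1" using * 1 by blast
      ultimately show ?l by simp
    qed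
    then show ?thesis using True by (simp add: h_def)
  qed (auto simp: h_def)
  have P': "dfn (\<lambda>e. P (e i) (e j))" for i j
    using dfn_reindex[OF P, of "\<lambda>k. if k = 0 then i else j"] by simp
  have "{xs. length xs = 2 \<and> h (xs ! 0) = xs ! 1} \<in> D 2"
  proof (rule D_I)
    have "dfn (\<lambda>e. h (e 0) = e 1)"
      unfolding h by (intro dfn_intros P')
    then show "dfn (\<lambda>e. h (map e [0..<2] ! 0) = map e [0..<2] ! 1)" by simp
  qed
  moreover have "{xs. length xs = 2 \<and> h (xs ! 0) = xs ! 1} = {[x, h x] | x. True}"
    by (auto simp: length_Suc_conv numeral_2_eq_2)
  ultimately obtain N c where N: "\<forall>x>c. \<bar>h x\<bar> < x ^ N"
    using pb unfolding polynomially_bounded_def by auto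
  show thesis
  proof
    fix s assume s: "s > max c s1"
    have "Inf {v. 1 \<le> v \<and> P s v} < h s" using s by (simp add: h_def)
    then obtain v where "v \<in> {v. 1 \<le> v \<and> P s v}" "v < h s"
      using cInf_lessD[OF ne] s by force
    moreover have "h s < s ^ N" using N[rule_format, of s] s by simp
    ultimately show "\<exists>v\<ge>1. P s v \<and> v < s ^ N" by force
  qed
qed

end

text \<open>For pairs \<open>(\<bar>g x\<bar>, \<bar>f x\<bar>)\<close> this says that
  \<open>f\<close> stays away from 0 where \<open>g\<close> does. It guarantees a finite reciprocal
  bound at every positive argument.\<close>

definition admissible :: "real list set \<Rightarrow> real list \<Rightarrow> bool" where
  "admissible W t \<longleftrightarrow> (\<forall>s. 0 < s \<longrightarrow> (\<exists>\<rho>. 0 < \<rho> \<and> (\<forall>z y. t @ [z, y] \<in> W \<longrightarrow> s \<le> z \<longrightarrow> \<rho> \<le> y)))"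

text \<open>\<open>recip_bound W t x v\<close> says that \<open>v\<close> bounds \<open>1/y\<close> for all \<open>(z, y)\<close> in the fibre
  with \<open>z \<ge> 1/x\<close>; the least such \<open>v\<close> is a nondecreasing function of \<open>x\<close>, and \<open>doubling W t s x\<close>
  says that it grows at most by the factor \<open>s\<close> from \<open>x\<close> to \<open>2 x\<close>.\<close>

definition recip_bound :: "real list set \<Rightarrow> real list \<Rightarrow> real \<Rightarrow> real \<Rightarrow> bool" where
  "recip_bound W t x v \<longleftrightarrow> (\<forall>z y. t @ [z, y] \<in> W \<longrightarrow> 1 \<le> z * x \<longrightarrow> 1 \<le> v * y)"

definition doubling :: "real list set \<Rightarrow> real list \<Rightarrow> real \<Rightarrow> real \<Rightarrow> bool" where
  "doubling W t s x \<longleftrightarrow> (\<forall>v. 1 \<le> v \<longrightarrow> recip_bound W t x v \<longrightarrow> recip_bound W t (2 * x) (s * v))"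

lemma recip_bound_mono:
  assumes "recip_bound W t x' v" "0 < x" "x \<le> x'" "1 \<le> v" "v \<le> v'"
  shows "recip_bound W t x v'"
  unfolding recip_bound_def
proof (intro allI impI)
  fix z y assume *: "t @ [z, y] \<in> W" "1 \<le> z * x"
  then have "0 < z" using \<open>0 < x\<close> by (metis less_le_trans zero_less_mult_pos2 zero_less_one)
  then have "1 \<le> z * x'" using * assms(3) by (meson mult_left_mono order_trans less_imp_le)
  then have y: "1 \<le> v * y" using assms(1) * unfolding recip_bound_def by blast
  then have "0 < y" using assms(4) by (metis less_le_trans zero_less_mult_pos zero_less_one)
  then show "1 \<le> v' * y" using y assms(5) by (meson mult_right_mono order_trans less_imp_le)
qed

lemma admissible_recip_bound:
  assumes "admissible W t" "0 < x"
  obtains v where "1 \<le> v" "recip_bound W t x v"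
proof -
  obtain \<rho> where \<rho>: "0 < \<rho>" "\<And>z y. t @ [z, y] \<in> W \<Longrightarrow> 1 / x \<le> z \<Longrightarrow> \<rho> \<le> y"
    using assms unfolding admissible_def by (metis zero_less_divide_1_iff)
  have "recip_bound W t x (max 1 (1 / \<rho>))"
    unfolding recip_bound_def
  proof (intro allI impI)
    fix z y assume "t @ [z, y] \<in> W" "1 \<le> z * x"
    then have "\<rho> \<le> y" using \<rho>(2) assms(2) by (simp add: pos_divide_le_eq)
    then have "1 \<le> 1 / \<rho> * y" using \<rho>(1) by simp
    also have "\<dots> \<le> max 1 (1 / \<rho>) * y" using \<open>\<rho> \<le> y\<close> \<rho>(1) by (intro mult_right_mono) auto
    finally show "1 \<le> max 1 (1 / \<rho>) * y" .
  qed
  then show thesis using that[of "max 1 (1 / \<rho>)"] by simp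
qed

text \<open>After \<open>k\<close> doublings from \<open>x0\<close> the bound is
  \<open>s ^ k * v0\<close>, at most a constant times the \<open>M\<close>-th power of the argument
  because \<open>s \<le> 2 ^ M\<close>. One more factor \<open>z\<close> absorbs the constant. Thus
  the exponent depends on \<open>s\<close> only; the parameter \<open>t\<close> affects just the
  threshold.\<close>

lemma doubling_imp_power_bound:
  assumes adm: "admissible W t" and s: "1 \<le> s" "s \<le> 2 ^ M"
    and ev: "\<forall>\<^sub>F x in at_top. doubling W t s x"
  shows "\<exists>s0>0. \<forall>z y. t @ [z, y] \<in> W \<longrightarrow> 0 < z \<longrightarrow> z < s0 \<longrightarrow> z ^ Suc M \<le> y"
proof -
  obtain x1 where x1: "\<And>x. x1 \<le> x \<Longrightarrow> doubling W t s x" using ev by (auto simp: eventually_at_top_linorder)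
  define x0 where "x0 = max 1 x1"
  have x0: "1 \<le> x0" "\<And>x. x0 \<le> x \<Longrightarrow> doubling W t s x" using x1 by (auto simp: x0_def)
  obtain v0 where v0: "1 \<le> v0" "recip_bound W t x0 v0"
    using admissible_recip_bound[OF adm, of x0] x0(1) by auto
  have iter: "recip_bound W t (2 ^ k * x0) (s ^ k * v0)" for k
  proof (induction k)
    case 0
    then show ?case using v0 by simp
  next
    case (Suc k)
    have "x0 \<le> 2 ^ k * x0" using x0(1) by simp
    moreover have "1 \<le> s ^ k * v0" using mult_mono[of 1 "s ^ k" 1 v0] one_le_power[OF s(1), of k] v0(1) by simp
    ultimately have "recip_bound W t (2 * (2 ^ k * x0)) (s * (s ^ k * v0))"
      using x0(2) Suc.IH unfolding doubling_def by blast
    then show ?case by (simp add: mult.assoc)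
  qed
  show ?thesis
  \<comment> \<open>The first term puts \<open>1 / z\<close> beyond \<open>x0\<close>; the second
    lets a factor \<open>z\<close> outweigh the constant \<open>2 ^ M * v0\<close>.\<close>
  proof (intro exI[of _ "min (1 / x0) (1 / (2 ^ M * v0))"] conjI allI impI)
    show "0 < min (1 / x0) (1 / (2 ^ M * v0))" using x0(1) v0(1) by simp
    fix z y assume zy: "t @ [z, y] \<in> W" and z: "0 < z" "z < min (1 / x0) (1 / (2 ^ M * v0))"
    define x where "x = 1 / z"
    have x: "x0 < x" "z * x = 1" "0 < x" using z x0(1) by (auto simp: x_def field_simps)
    obtain k0 where "x < 2 ^ k0" using real_arch_pow[of 2 x] by auto
    also have "2 ^ k0 \<le> 2 ^ k0 * x0" using x0(1) by simp
    finally have "x \<le> 2 ^ k0 * x0" by simp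
    \<comment> \<open>Minimality gives \<open>2 ^ k * x0 < 2 * x\<close>, which turns the power of
      \<open>s\<close> into a power of \<open>x\<close>.\<close>
    define k where "k = (LEAST k. x \<le> 2 ^ k * x0)"
    have k: "x \<le> 2 ^ k * x0" unfolding k_def using \<open>x \<le> 2 ^ k0 * x0\<close> by (rule LeastI)
    have "k \<noteq> 0" using k x(1) by (intro notI) simp
    then obtain k' where k': "k = Suc k'" using not0_implies_Suc by blast
    then have "\<not> x \<le> 2 ^ k' * x0" using not_less_Least[of k' "\<lambda>k. x \<le> 2 ^ k * x0"] by (simp add: k_def)
    then have "2 ^ k * x0 < 2 * x" by (simp add: k')
    moreover have "2 ^ k \<le> 2 ^ k * x0" using x0(1) by simp
    ultimately have k2: "2 ^ k \<le> 2 * x" by (rule order_trans[OF _ less_imp_le, rotated])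
    have "s ^ k \<le> (2 ^ M) ^ k" using s by (intro power_mono) auto
    also have "\<dots> = (2 ^ k) ^ M" by (simp add: mult.commute flip: power_mult)
    also have "\<dots> \<le> (2 * x) ^ M" using k2 by (intro power_mono) auto
    finally have sk: "s ^ k \<le> (2 * x) ^ M" .
    have "1 \<le> s ^ k * v0" using mult_mono[of 1 "s ^ k" 1 v0] one_le_power[OF s(1), of k] v0(1) by simp
    then have "recip_bound W t x ((2 * x) ^ M * v0)"
      using recip_bound_mono[OF iter x(3) k] sk v0(1) by (simp add: mult_right_mono)
    then have y1: "1 \<le> (2 * x) ^ M * v0 * y"
      using zy x(2) unfolding recip_bound_def by simp
    have "z ^ M * 1 \<le> z ^ M * ((2 * x) ^ M * v0 * y)"
      using y1 z(1) by (intro mult_left_mono) auto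
    also have "\<dots> = (z * x) ^ M * (2 ^ M * v0 * y)"
      by (simp add: power_mult_distrib mult_ac)
    finally have 1: "z ^ M \<le> 2 ^ M * v0 * y" by (simp add: x(2))
    have "z * (2 ^ M * v0) < 1" using z(2) v0(1) by (simp add: pos_less_divide_eq)
    then have "z ^ M * (z * (2 ^ M * v0)) \<le> z ^ M * 1" using z(1) by (intro mult_left_mono) auto
    then have "(2 ^ M * v0) * z ^ Suc M \<le> (2 ^ M * v0) * y" using 1 by (simp add: mult_ac)
    then show "z ^ Suc M \<le> y" using v0(1) by (simp add: mult_le_cancel_left_pos)
  qed
qed

context o_minimal
begin

text \<open>If the doubling factors were unbounded, then a parameter depending on \<open>s\<close> would give a
  definable function exceeding \<open>s ^ K\<close> for every \<open>K\<close> at a polynomially bounded argument.\<close>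

theorem uniform_exponent:
  assumes pb: "polynomially_bounded D" and W: "W \<in> D n"
  shows "\<exists>N. \<forall>t. length t = d \<longrightarrow> admissible W t \<longrightarrow>
    (\<exists>s0>0. \<forall>z y. t @ [z, y] \<in> W \<longrightarrow> 0 < z \<longrightarrow> z < s0 \<longrightarrow> z ^ N \<le> y)"
proof (cases "\<exists>s\<ge>1. \<forall>t. length t = d \<longrightarrow> admissible W t \<longrightarrow> (\<forall>\<^sub>F x in at_top. doubling W t s x)")
  case True
  then obtain s where s: "1 \<le> s"
      "\<And>t. length t = d \<Longrightarrow> admissible W t \<Longrightarrow> \<forall>\<^sub>F x in at_top. doubling W t s x"
    by blast
  obtain M where "s < 2 ^ M" using real_arch_pow[of 2 s] by auto
  then have "\<exists>s0>0. \<forall>z y. t @ [z, y] \<in> W \<longrightarrow> 0 < z \<longrightarrow> z < s0 \<longrightarrow> z ^ Suc M \<le> y"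
    if "length t = d" "admissible W t" for t
    using doubling_imp_power_bound[OF that(2) s(1) _ s(2)[OF that]] by simp
  then show ?thesis by blast
next
  case False
  \<comment> \<open>No single factor works for all parameters. \<open>Q s c\<close> records a
    parameter for which the factor \<open>s\<close> fails at every argument from \<open>c\<close>
    on.\<close>
  define Q where "Q s c \<longleftrightarrow> (\<exists>t. length t = d \<and> admissible W t \<and> (\<forall>x. c \<le> x \<longrightarrow> \<not> doubling W t s x))" for s c
  have exQ: "\<exists>c\<ge>1. Q s c" if "s > 1" for s
  proof -
    have "\<exists>t. length t = d \<and> admissible W t \<and> \<not> (\<forall>\<^sub>F x in at_top. doubling W t s x)"
      using False that less_imp_le by blast
    then obtain t where t: "length t = d" "admissible W t" "\<not> (\<forall>\<^sub>F x in at_top. doubling W t s x)"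
      by blast
    \<comment> \<open>By o-minimality, not holding eventually means failing eventually.\<close>
    have "dfn (\<lambda>e. doubling W t s (e 0))"
      unfolding doubling_def recip_bound_def by (intro dfn_intros dfn_mem[OF W])
    then have "\<forall>\<^sub>F x in at_top. \<not> doubling W t s x" using dfn_eventually_or t(3) by blast
    then obtain c where "\<And>x. c \<le> x \<Longrightarrow> \<not> doubling W t s x" by (auto simp: eventually_at_top_linorder)
    then have "Q s (max 1 c)" unfolding Q_def using t by auto
    then show ?thesis by (intro exI[of _ "max 1 c"]) auto
  qed
  have dfnQ: "dfn (\<lambda>e. Q (e 0) (e 1))"
    unfolding Q_def admissible_def doubling_def recip_bound_def by (intro dfn_intros dfn_mem[OF W])
  obtain M c1 where M: "\<And>s. s > c1 \<Longrightarrow> \<exists>c\<ge>1. Q s c \<and> c < s ^ M"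
    by (rule polynomially_bounded_selection[OF pb dfnQ exQ]) (assumption, rule that)
  \<comment> \<open>The same \<open>t\<close> must witness both the failure of doubling and the
    bound \<open>v\<close>. The bound is taken at \<open>s ^ Suc M\<close>, not
    \<open>s ^ M\<close>, to leave a factor \<open>s\<close> of room above \<open>c\<close> for the
    doublings below, whose number \<open>K\<close> is not yet known.\<close>
  define V where "V s v \<longleftrightarrow> (\<exists>t. length t = d \<and> admissible W t \<and>
    (\<exists>c. 1 \<le> c \<and> c < s ^ M \<and> (\<forall>x. c \<le> x \<longrightarrow> \<not> doubling W t s x)) \<and> recip_bound W t (s ^ Suc M) v)" for s v
  have exV: "\<exists>v\<ge>1. V s v" if s: "s > max 1 c1" for s
  proof -
    obtain c where c: "1 \<le> c" "Q s c" "c < s ^ M" using M s by force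
    then obtain t where t: "length t = d" "admissible W t" "\<forall>x. c \<le> x \<longrightarrow> \<not> doubling W t s x"
      unfolding Q_def by blast
    have "0 < s ^ Suc M" using s by simp
    then obtain v where "1 \<le> v" "recip_bound W t (s ^ Suc M) v" using admissible_recip_bound[OF t(2)] by blast
    then show ?thesis unfolding V_def using c t by blast
  qed
  have dfnV: "dfn (\<lambda>e. V (e 0) (e 1))"
    unfolding V_def admissible_def doubling_def recip_bound_def by (intro dfn_intros dfn_mem[OF W])
  obtain K c2 where K: "\<And>s. s > c2 \<Longrightarrow> \<exists>v\<ge>1. V s v \<and> v < s ^ K"
    by (rule polynomially_bounded_selection[OF pb dfnV exV]) (assumption, rule that)
  \<comment> \<open>With \<open>s \<ge> 2 ^ K\<close>, starting at \<open>c < s ^ M\<close>,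
    \<open>K\<close> doublings end at or below \<open>s ^ Suc M\<close>.\<close>
  define s where "s = max c2 (2 ^ K) + 1"
  have s: "s > c2" "2 ^ K \<le> s" "1 \<le> s"
    by (auto simp: s_def le_max_iff_disj)
  obtain v where v: "1 \<le> v" "V s v" "v < s ^ K" using K[OF s(1)] by blast
  then obtain t c where t: "1 \<le> c" "c < s ^ M" "\<And>x. c \<le> x \<Longrightarrow> \<not> doubling W t s x"
      "recip_bound W t (s ^ Suc M) v"
    unfolding V_def by blast
  \<comment> \<open>Failure at \<open>2 ^ k * c\<close> gives a bound \<open>v1\<close> there such
    that no bound after the next doubling is \<open>\<le> s * v1\<close>. So each doubling costs a
    factor \<open>s\<close>, and \<open>K\<close> of them contradict
    \<open>v < s ^ K\<close>.\<close>
  have growth: "s ^ k \<le> v" if "1 \<le> v" "recip_bound W t (2 ^ k * c) v" for k v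
    using that
  proof (induction k arbitrary: v)
    case 0
    then show ?case by simp
  next
    case (Suc k)
    have "c \<le> 2 ^ k * c" using t(1) by simp
    then obtain v1 where v1: "1 \<le> v1" "recip_bound W t (2 ^ k * c) v1"
        "\<not> recip_bound W t (2 * (2 ^ k * c)) (s * v1)"
      using t(3) unfolding doubling_def by blast
    have "0 < 2 * (2 ^ k * c)" using t(1) by simp
    then have "\<not> v \<le> s * v1"
      using v1(3) recip_bound_mono[of W t "2 * (2 ^ k * c)" v "2 * (2 ^ k * c)" "s * v1"] Suc.prems
      by (auto simp: mult.assoc)
    moreover have "s * s ^ k \<le> s * v1" using Suc.IH[OF v1(1,2)] s(3) by (intro mult_left_mono) auto
    ultimately show ?case by simp
  qed
  have "2 ^ K * c \<le> s * s ^ M" using s(2,3) t(1,2) by (intro mult_mono) auto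
  then have "recip_bound W t (2 ^ K * c) v"
    using recip_bound_mono[OF t(4), of "2 ^ K * c" v] t(1) v(1) by simp
  then have False using growth[OF v(1)] v(3) by (simp add: not_le[symmetric])
  then show ?thesis ..
qed

end

section \<open>The metric space of lists of length n\<close>

lemma ldist_L2_set: "ldist x y = L2_set (\<lambda>i. x ! i - y ! i) {..<length x}"
  by (simp add: ldist_def L2_set_def)

lemma coordinate_le_ldist: "i < length x \<Longrightarrow> \<bar>x ! i - y ! i\<bar> \<le> ldist x y"
  using member_le_L2_set[of "{..<length x}" i "\<lambda>i. \<bar>x ! i - y ! i\<bar>"]
  by (simp add: ldist_def L2_set_def)

lemma ldist_less:
  assumes "0 < e" "\<And>i. i < length x \<Longrightarrow> \<bar>x ! i - y ! i\<bar> < e / (length x + 1)"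
  shows "ldist x y < e"
proof -
  have "ldist x y \<le> (\<Sum>i<length x. \<bar>x ! i - y ! i\<bar>)"
    unfolding ldist_L2_set by (rule L2_set_le_sum_abs)
  also have "\<dots> \<le> (\<Sum>i<length x. e / (length x + 1))"
    using assms(2) by (intro sum_mono) (simp add: less_imp_le)
  also have "\<dots> < e" using assms(1) by (simp add: field_simps)
  finally show ?thesis .
qed

text \<open>This filter turns \<open>lcont_on\<close> into convergence, so that the limit rules can
  be used.\<close>

definition lnhds :: "real list set \<Rightarrow> real list \<Rightarrow> real list filter" where
  "lnhds S x = (INF d\<in>{0<..}. principal {y \<in> S. ldist x y < d})"

lemma eventually_lnhds: "eventually P (lnhds S x) \<longleftrightarrow> (\<exists>d>0. \<forall>y\<in>S. ldist x y < d \<longrightarrow> P y)"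
  unfolding lnhds_def
proof (subst eventually_INF_base)
  fix a b :: real assume "a \<in> {0<..}" "b \<in> {0<..}"
  then show "\<exists>d\<in>{0<..}. principal {y \<in> S. ldist x y < d} \<le>
      inf (principal {y \<in> S. ldist x y < a}) (principal {y \<in> S. ldist x y < b})"
    by (intro bexI[of _ "min a b"]) auto
qed (auto simp: eventually_principal)

lemma lcont_on_tendsto: "lcont_on S f \<longleftrightarrow> (\<forall>x\<in>S. (f \<longlongrightarrow> f x) (lnhds S x))"
  unfolding lcont_on_def tendsto_iff eventually_lnhds dist_real_def by blast

text \<open>Bolzano-Weierstrass, from a common subsequence for all coordinates.\<close>

lemma bounded_sequence_converges:
  fixes X :: "nat \<Rightarrow> real list"
  assumes "\<And>j. length (X j) = n" "\<And>j i. i < n \<Longrightarrow> \<bar>X j ! i\<bar> \<le> c"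
  obtains l r where "length l = n" "strict_mono r" "\<And>e. 0 < e \<Longrightarrow> \<forall>\<^sub>F j in sequentially. ldist l (X (r j)) < e"
proof -
  have "\<forall>d\<subseteq>{..<n}. \<exists>l :: nat \<Rightarrow> real. \<exists>r. strict_mono r \<and>
      (\<forall>e>0. \<forall>\<^sub>F j in sequentially. \<forall>i\<in>d. dist (X (r j) ! i) (l i) < e)"
  proof (rule compact_lemma_general[where f = "\<lambda>j i. X j ! i" and proj = "\<lambda>f i. f i" and unproj = "\<lambda>f. f"])
    fix i assume "i \<in> {..<n}"
    then show "bounded ((\<lambda>f. f i) ` range (\<lambda>j i. X j ! i))"
      using assms(2) by (auto simp: bounded_iff)
  qed auto
  then obtain l r where lr: "strict_mono r"
      "\<And>e. 0 < e \<Longrightarrow> \<forall>\<^sub>F j in sequentially. \<forall>i\<in>{..<n}. dist (X (r j) ! i) (l i) < e"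
    by blast
  have "\<forall>\<^sub>F j in sequentially. ldist (map l [0..<n]) (X (r j)) < e" if "0 < e" for e :: real
  proof -
    have "0 < e / (n + 1)" using that by simp
    from lr(2)[OF this] show ?thesis
    proof eventually_elim
      case (elim j)
      then show ?case using that by (intro ldist_less) (auto simp: dist_real_def abs_minus_commute)
    qed
  qed
  then show thesis using that[of "map l [0..<n]" r] lr(1) by simp
qed

text \<open>Otherwise points of the box with \<open>\<bar>g\<bar> \<ge> s\<close> and
  \<open>f\<close> tending to 0 accumulate at a point of the closed set \<open>S\<close>, where
  \<open>f\<close> vanishes by continuity but \<open>g\<close> does not.\<close>

lemma positive_bound_on_box:
  assumes S: "lclosed n S" and f: "lcont_on S f" and g: "lcont_on S g"
    and zero: "\<forall>x\<in>S. f x = 0 \<longrightarrow> g x = 0" and x0: "length x0 = n" and s: "0 < s"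
  shows "\<exists>\<rho>>0. \<forall>x\<in>S. (\<forall>i<n. \<bar>x ! i - x0 ! i\<bar> \<le> 1) \<longrightarrow> s \<le> \<bar>g x\<bar> \<longrightarrow> \<rho> \<le> \<bar>f x\<bar>"
proof (rule ccontr)
  assume neg: "\<not> ?thesis"
  have "\<exists>x\<in>S. (\<forall>i<n. \<bar>x ! i - x0 ! i\<bar> \<le> 1) \<and> s \<le> \<bar>g x\<bar> \<and> \<bar>f x\<bar> < 1 / Suc j" for j
    using neg by (meson not_le of_nat_0_less_iff zero_less_Suc zero_less_divide_1_iff)
  then obtain X where X: "\<And>j. X j \<in> S" "\<And>j i. i < n \<Longrightarrow> \<bar>X j ! i - x0 ! i\<bar> \<le> 1"
      "\<And>j. s \<le> \<bar>g (X j)\<bar>" "\<And>j. \<bar>f (X j)\<bar> < 1 / Suc j"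
    by metis
  define c where "c = (\<Sum>i<n. \<bar>x0 ! i\<bar>) + 1"
  have "\<bar>X j ! i\<bar> \<le> c" if "i < n" for i j
  proof -
    have "\<bar>x0 ! i\<bar> \<le> (\<Sum>i<n. \<bar>x0 ! i\<bar>)" using that by (intro member_le_sum) auto
    then show ?thesis using X(2)[OF that, of j] by (simp add: c_def)
  qed
  moreover have "length (X j) = n" for j using S X(1)[of j] by (auto simp: lclosed_def Rn_def)
  ultimately obtain l r where l: "length l = n" "strict_mono r"
      "\<And>e. 0 < e \<Longrightarrow> \<forall>\<^sub>F j in sequentially. ldist l (X (r j)) < e"
    using bounded_sequence_converges[of X n c] by blast
  have "\<exists>y\<in>S. ldist l y < e" if "0 < e" for e
    using eventually_happens[OF l(3)[OF that]] X(1) by auto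
  then have lS: "l \<in> S" using S l(1) by (auto simp: lclosed_def Rn_def)
  have lim: "filterlim (\<lambda>j. X (r j)) (lnhds S l) sequentially"
    unfolding filterlim_iff eventually_lnhds
  proof (intro allI impI)
    fix P assume "\<exists>d>0. \<forall>y\<in>S. ldist l y < d \<longrightarrow> P y"
    then obtain d where "0 < d" "\<And>y. y \<in> S \<Longrightarrow> ldist l y < d \<Longrightarrow> P y" by blast
    then show "\<forall>\<^sub>F j in sequentially. P (X (r j))"
      using l(3)[of d] X(1) by (auto elim: eventually_mono)
  qed
  have lim_f: "(\<lambda>j. f (X (r j))) \<longlonglongrightarrow> f l"
    using f lS unfolding lcont_on_tendsto by (intro filterlim_compose[OF _ lim]) blast
  have lim_g: "(\<lambda>j. g (X (r j))) \<longlonglongrightarrow> g l"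
    using g lS unfolding lcont_on_tendsto by (intro filterlim_compose[OF _ lim]) blast
  have "(\<lambda>j. f (X (r j))) \<longlonglongrightarrow> 0"
  proof (rule Lim_null_comparison)
    show "(\<lambda>j. 1 / real (Suc (r j))) \<longlonglongrightarrow> 0"
      using LIMSEQ_subseq_LIMSEQ[OF LIMSEQ_inverse_real_of_nat l(2)] by (simp add: o_def inverse_eq_divide)
    show "\<forall>\<^sub>F j in sequentially. norm (f (X (r j))) \<le> 1 / real (Suc (r j))"
      using X(4) by (intro always_eventually) (auto intro: less_imp_le)
  qed
  then have "f l = 0" using LIMSEQ_unique[OF lim_f] by blast
  moreover have "s \<le> \<bar>g l\<bar>"
    by (rule tendsto_lowerbound[OF tendsto_rabs[OF lim_g]]) (use X(3) in auto)
  ultimately show False using zero lS s by force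
qed

section \<open>Division with a uniform exponent\<close>

text \<open>This carries constancy along a cell from the generating fibres to every set they
  generate.\<close>

lemma bool_alg_cong:
  assumes "X \<in> bool_alg n \<G>" "x \<in> Rn n" "x' \<in> Rn n" "\<And>G. G \<in> \<G> \<Longrightarrow> x \<in> G \<longleftrightarrow> x' \<in> G"
  shows "x \<in> X \<longleftrightarrow> x' \<in> X"
  using assms by (induction rule: bool_alg.induct) auto

context o_minimal
begin

lemma bool_alg_D:
  assumes "X \<in> bool_alg n \<G>" "\<And>G. G \<in> \<G> \<Longrightarrow> G \<in> D n" shows "X \<in> D n"
  using assms by (induction rule: bool_alg.induct) (auto intro: D_empty D_Compl D_Un)

lemma D_fiber:
  assumes "\<A> \<in> D (m + n)" "length a = m" shows "fiber \<A> a \<in> D n"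
proof -
  have "{y. length y = n \<and> a @ y \<in> \<A>} \<in> D n"
    by (intro D_I dfn_mem[OF assms(1)] dfn_intros)
  moreover have "{y. length y = n \<and> a @ y \<in> \<A>} = fiber \<A> a"
    using D_length[OF assms(1)] assms(2) by (force simp: fiber_def)
  ultimately show ?thesis by simp
qed

text \<open>The order of quantifiers is the point: \<open>\<Psi>\<close> depends on the family only,
  while the list \<open>Q\<close> of cells with parameters may grow with \<open>A'\<close>.
  \<open>Q\<close> collects exactly the available cells that lie inside \<open>S\<close>.\<close>

lemma family_cells:
  assumes \<A>: "\<A> \<in> D (m + n)"
  obtains \<Psi> where "finite \<Psi>" "\<And>d \<psi>. (d, \<psi>) \<in> \<Psi> \<Longrightarrow> \<psi> \<in> D (d + n)"
    "\<And>A' S. finite A' \<Longrightarrow> A' \<subseteq> Rn m \<Longrightarrow> S \<in> bool_alg n (fiber \<A> ` A') \<Longrightarrow>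
      \<exists>Q. finite Q \<and> (\<forall>(d, \<psi>, b)\<in>Q. (d, \<psi>) \<in> \<Psi> \<and> length b = d \<and> (\<forall>x. length x = n \<longrightarrow> b @ x \<in> \<psi> \<longrightarrow> x \<in> S)) \<and>
        (\<forall>x\<in>S. \<exists>(d, \<psi>, b)\<in>Q. b @ x \<in> \<psi>)"
proof -
  obtain \<Psi> where \<Psi>: "cell_cover 0 m n \<A> \<Psi>" using cell_cover_exists[of \<A> 0 m n] \<A> by auto
  define \<Psi>' where "\<Psi>' = (\<lambda>(k, \<psi>). (k * m, \<psi>)) ` \<Psi>"
  show thesis
  proof
    show "finite \<Psi>'" using \<Psi> by (simp add: \<Psi>'_def cell_cover_def)
    show "\<psi> \<in> D (d + n)" if "(d, \<psi>) \<in> \<Psi>'" for d \<psi>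
      using that \<Psi> by (auto simp: \<Psi>'_def cell_cover_def)
    fix A' S
    assume A': "finite A'" "A' \<subseteq> Rn m" and S: "S \<in> bool_alg n (fiber \<A> ` A')"
    \<comment> \<open>Covers need a nonempty parameter set, so a dummy point is added in case
      \<open>A'\<close> is empty; constancy for more fibres does no harm.\<close>
    define A0 where "A0 = insert (replicate m 0) A'"
    have A0: "finite A0" "A0 \<noteq> {}" "A0 \<subseteq> Rn m" using A' by (auto simp: A0_def Rn_def)
    have "fiber \<A> a \<in> D n" if "a \<in> A'" for a using D_fiber[OF \<A>] A'(2) that by (auto simp: Rn_def)
    then have SD: "S \<in> D n" by (intro bool_alg_D[OF S]) auto
    define U where "U = (\<Union>(k, \<psi>)\<in>\<Psi>. (\<lambda>as. (k * m, \<psi>, concat as)) ` {as. set as \<subseteq> A0 \<and> length as = k})"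
    define Q where "Q = {q \<in> U. \<forall>x. length x = n \<longrightarrow> snd (snd q) @ x \<in> fst (snd q) \<longrightarrow> x \<in> S}"
    have "finite U"
      unfolding U_def using \<Psi> A0(1) by (auto simp: cell_cover_def intro!: finite_lists_length_eq)
    then have "finite Q" by (simp add: Q_def)
    have "(d, \<psi>) \<in> \<Psi>' \<and> length b = d" if dU: "(d, \<psi>, b) \<in> U" for d \<psi> b
    proof -
      obtain k as where "(k, \<psi>) \<in> \<Psi>" "d = k * m" "b = concat as" "set as \<subseteq> A0" "length as = k"
        using dU unfolding U_def by blast
      then show ?thesis using length_concat_Rn[of as m] A0(3) by (force simp: \<Psi>'_def)
    qed
    then have "\<forall>(d, \<psi>, b)\<in>Q. (d, \<psi>) \<in> \<Psi>' \<and> length b = d \<and> (\<forall>x. length x = n \<longrightarrow> b @ x \<in> \<psi> \<longrightarrow> x \<in> S)"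
      unfolding Q_def by auto
    moreover have "\<exists>(d, \<psi>, b)\<in>Q. b @ x \<in> \<psi>" if x: "x \<in> S" for x
    proof -
      have xn: "length x = n" using D_length[OF SD x] .
      obtain k \<psi> as where c: "(k, \<psi>) \<in> \<Psi>" "\<psi> \<in> D (0 + k * m + n)" "length as = k" "set as \<subseteq> A0"
        "[] @ concat as @ x \<in> \<psi>"
        "\<And>a x'. a \<in> A0 \<Longrightarrow> length x' = n \<Longrightarrow> [] @ concat as @ x' \<in> \<psi> \<Longrightarrow> [] @ a @ x' \<in> \<A> \<longleftrightarrow> [] @ a @ x \<in> \<A>"
        by (rule cell_coverD[OF \<Psi> _ A0 xn, of "[]"]) (simp, rule that)
      have "x' \<in> S" if "length x' = n" "concat as @ x' \<in> \<psi>" for x'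
      proof -
        have "x \<in> S \<longleftrightarrow> x' \<in> S"
          using c(6) that xn by (intro bool_alg_cong[OF S]) (auto simp: Rn_def fiber_def A0_def)
        then show ?thesis using x by simp
      qed
      moreover have "(k * m, \<psi>, concat as) \<in> U"
        unfolding U_def using c(1,3,4) by blast
      ultimately have "(k * m, \<psi>, concat as) \<in> Q"
        unfolding Q_def by simp
      then show ?thesis using c(5) by (intro bexI[of _ "(k * m, \<psi>, concat as)"]) simp_all
    qed
    ultimately show "\<exists>Q. finite Q \<and> (\<forall>(d, \<psi>, b)\<in>Q. (d, \<psi>) \<in> \<Psi>' \<and> length b = d \<and> (\<forall>x. length x = n \<longrightarrow> b @ x \<in> \<psi> \<longrightarrow> x \<in> S)) \<and>
        (\<forall>x\<in>S. \<exists>(d, \<psi>, b)\<in>Q. b @ x \<in> \<psi>)"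
      using \<open>finite Q\<close> by (intro exI[of _ Q] conjI) (assumption, assumption, rule ballI)
  qed
qed

end

text \<open>Pairs of points at sup-norm distance at most 1. The sup norm avoids the square root in
  \<open>ldist\<close>, and the concatenated list makes the relation a member of
  \<open>D (n + n)\<close>.\<close>

definition unit_box :: "nat \<Rightarrow> real list set" where
  "unit_box n = {zs. length zs = n + n \<and> (\<forall>i\<in>{..<n}. \<bar>zs ! i - zs ! (n + i)\<bar> \<le> 1)}"

text \<open>The values \<open>(\<bar>g x\<bar>, \<bar>f x\<bar>)\<close> for \<open>x\<close> near \<open>x0\<close> in a cell of \<open>S\<close> such that
  \<open>(x, f x)\<close> and \<open>(x, g x)\<close> lie in given cells of the graphs.\<close>

definition cell_values ::
  "nat \<Rightarrow> nat \<Rightarrow> real list set \<Rightarrow> nat \<Rightarrow> real list set \<Rightarrow> nat \<Rightarrow> real list set \<Rightarrow> real list set" where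
  "cell_values n d1 \<psi>1 d2 \<psi>2 d3 \<psi>3 = {zs. length zs = d1 + d2 + d3 + n + 2 \<and>
    (\<exists>a. length a = d1 \<and> (\<exists>b. length b = d2 \<and> (\<exists>c. length c = d3 \<and> (\<exists>x0. length x0 = n \<and>
      (\<exists>u v. zs = a @ b @ c @ x0 @ [\<bar>v\<bar>, \<bar>u\<bar>] \<and>
        (\<exists>x. length x = n \<and> x @ x0 \<in> unit_box n \<and> a @ x \<in> \<psi>1 \<and>
          b @ x @ [u] \<in> \<psi>2 \<and> c @ x @ [v] \<in> \<psi>3))))))}"

context o_minimal
begin

lemma D_unit_box: "unit_box n \<in> D (n + n)"
  unfolding unit_box_def
proof (intro D_I dfn_finite_ball)
  fix i assume "i \<in> {..<n}"
  moreover have "dfn (\<lambda>e. \<bar>e i - e (n + i)\<bar> \<le> 1)" by (intro dfn_intros)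
  ultimately show "dfn (\<lambda>e. \<bar>map e [0..<n + n] ! i - map e [0..<n + n] ! (n + i)\<bar> \<le> 1)" by simp
qed simp

lemma D_cell_values:
  assumes "\<psi>1 \<in> D (d1 + n)" "\<psi>2 \<in> D (d2 + Suc n)" "\<psi>3 \<in> D (d3 + Suc n)"
  shows "cell_values n d1 \<psi>1 d2 \<psi>2 d3 \<psi>3 \<in> D (d1 + d2 + d3 + n + 2)"
  unfolding cell_values_def
  by (intro D_I dfn_intros dfn_mem[OF D_unit_box] dfn_mem[OF assms(1)] dfn_mem[OF assms(2)] dfn_mem[OF assms(3)])

lemma cell_values_iff:
  assumes "length a = d1" "length b = d2" "length c = d3" "length x0 = n"
  shows "(a @ b @ c @ x0) @ [z, y] \<in> cell_values n d1 \<psi>1 d2 \<psi>2 d3 \<psi>3 \<longleftrightarrow>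
    (\<exists>u v x. z = \<bar>v\<bar> \<and> y = \<bar>u\<bar> \<and> length x = n \<and> x @ x0 \<in> unit_box n \<and> a @ x \<in> \<psi>1 \<and> b @ x @ [u] \<in> \<psi>2 \<and> c @ x @ [v] \<in> \<psi>3)"
    (is "?l \<longleftrightarrow> ?r")
proof
  assume ?l
  then obtain a' b' c' x0' u v x where *: "length a' = d1" "length b' = d2" "length c' = d3" "length x0' = n"
      "(a @ b @ c @ x0) @ [z, y] = a' @ b' @ c' @ x0' @ [\<bar>v\<bar>, \<bar>u\<bar>]"
      "length x = n" "x @ x0' \<in> unit_box n" "a' @ x \<in> \<psi>1" "b' @ x @ [u] \<in> \<psi>2" "c' @ x @ [v] \<in> \<psi>3"
    unfolding cell_values_def by blast
  then have "a' = a" "b' = b" "c' = c" "x0' = x0" "z = \<bar>v\<bar>" "y = \<bar>u\<bar>" using assms by simp_all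
  then show ?r using * by blast
next
  assume ?r
  moreover have "length ((a @ b @ c @ x0) @ [z, y]) = d1 + d2 + d3 + n + 2" using assms by simp
  ultimately show ?l unfolding cell_values_def append_assoc using assms by blast
qed

lemma uniform_exponent_finite:
  assumes pb: "polynomially_bounded D" and "finite I" and W: "\<And>i. i \<in> I \<Longrightarrow> W i \<in> D (n i)"
  shows "\<exists>N. \<forall>i\<in>I. \<forall>t. length t = d i \<longrightarrow> admissible (W i) t \<longrightarrow>
    (\<exists>s0>0. \<forall>z y. t @ [z, y] \<in> W i \<longrightarrow> 0 < z \<longrightarrow> z < s0 \<longrightarrow> z ^ N \<le> y)"
proof -
  have "\<forall>i\<in>I. \<exists>N. \<forall>t. length t = d i \<longrightarrow> admissible (W i) t \<longrightarrow>
      (\<exists>s0>0. \<forall>z y. t @ [z, y] \<in> W i \<longrightarrow> 0 < z \<longrightarrow> z < s0 \<longrightarrow> z ^ N \<le> y)"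
    using uniform_exponent[OF pb W] by blast
  from bchoice[OF this] obtain N where N: "\<forall>i\<in>I. \<forall>t. length t = d i \<longrightarrow> admissible (W i) t \<longrightarrow>
      (\<exists>s0>0. \<forall>z y. t @ [z, y] \<in> W i \<longrightarrow> 0 < z \<longrightarrow> z < s0 \<longrightarrow> z ^ N i \<le> y)" ..
  define M where "M = Max (insert 0 (N ` I))"
  have M: "N i \<le> M" if "i \<in> I" for i using that \<open>finite I\<close> by (simp add: M_def)
  show ?thesis
  proof (intro exI[of _ M] ballI allI impI)
    fix i t assume i: "i \<in> I" and t: "length t = d i" "admissible (W i) t"
    then obtain s0 where s0: "s0 > 0" "\<forall>z y. t @ [z, y] \<in> W i \<longrightarrow> 0 < z \<longrightarrow> z < s0 \<longrightarrow> z ^ N i \<le> y"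
      using N by blast
    show "\<exists>s0>0. \<forall>z y. t @ [z, y] \<in> W i \<longrightarrow> 0 < z \<longrightarrow> z < s0 \<longrightarrow> z ^ M \<le> y"
    \<comment> \<open>Below 1, raising the exponent lowers the power, so the maximal exponent serves
      every index.\<close>
    proof (intro exI[of _ "min s0 1"] conjI allI impI)
      fix z y assume "t @ [z, y] \<in> W i" "0 < z" "z < min s0 1"
      then have "z ^ N i \<le> y" "z ^ M \<le> z ^ N i"
        using s0(2) M[OF i] by (auto intro: power_decreasing)
      then show "z ^ M \<le> y" by simp
    qed (use s0(1) in simp)
  qed
qed

end

theorem theorem5p14:
  fixes D :: "nat \<Rightarrow> real list set set"
    and n m k :: nat
    and A \<A> B \<B> :: "real list set"
  assumes "o_minimal_expansion D"
    and "polynomially_bounded D"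
    and "A \<in> D m"
    and "\<A> \<in> D (m + n)"
    and "\<A> \<subseteq> {a @ y | a y. a \<in> A \<and> y \<in> Rn n}"
    and "B \<in> D k"
    and "\<B> \<in> D (k + Suc n)"
    and "\<B> \<subseteq> {b @ y | b y. b \<in> B \<and> y \<in> Rn (Suc n)}"
  shows "\<exists>N::nat. N > 0 \<and>
    (\<forall>A' B' B'' S F G f g.
       finite A' \<and> A' \<subseteq> A \<and> finite B' \<and> B' \<subseteq> B \<and> finite B'' \<and> B'' \<subseteq> B \<and>
       S \<in> bool_alg n (fiber \<A> ` A') \<and> lclosed n S \<and>
       F \<in> bool_alg (Suc n) (fiber \<B> ` B') \<and>
       G \<in> bool_alg (Suc n) (fiber \<B> ` B'') \<and>
       lgraph_on (Rn n) f \<in> D (Suc n) \<and> lgraph_on (Rn n) g \<in> D (Suc n) \<and>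
       F = lgraph_on (Rn n) f \<and> G = lgraph_on (Rn n) g \<and>
       lcont_on S f \<and> lcont_on S g \<and>
       (\<forall>x\<in>S. f x = 0 \<longrightarrow> g x = 0)
       \<longrightarrow> (\<exists>h. lgraph_on S h \<in> D (Suc n) \<and> lcont_on S h \<and>
               (\<forall>x\<in>S. g x ^ N = h x * f x)))"
proof -
  interpret o_minimal D by unfold_locales (rule assms(1))
  obtain \<Psi>1 where \<Psi>1: "finite \<Psi>1" "\<And>d \<psi>. (d, \<psi>) \<in> \<Psi>1 \<Longrightarrow> \<psi> \<in> D (d + n)"
    "\<And>A' S. finite A' \<Longrightarrow> A' \<subseteq> Rn m \<Longrightarrow> S \<in> bool_alg n (fiber \<A> ` A') \<Longrightarrow>
      \<exists>Q. finite Q \<and> (\<forall>(d, \<psi>, b)\<in>Q. (d, \<psi>) \<in> \<Psi>1 \<and> length b = d \<and> (\<forall>x. length x = n \<longrightarrow> b @ x \<in> \<psi> \<longrightarrow> x \<in> S)) \<and>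
        (\<forall>x\<in>S. \<exists>(d, \<psi>, b)\<in>Q. b @ x \<in> \<psi>)"
    by (rule family_cells[OF assms(4)]) (rule that)
  obtain \<Psi>2 where \<Psi>2: "finite \<Psi>2" "\<And>d \<psi>. (d, \<psi>) \<in> \<Psi>2 \<Longrightarrow> \<psi> \<in> D (d + Suc n)"
    "\<And>A' S. finite A' \<Longrightarrow> A' \<subseteq> Rn k \<Longrightarrow> S \<in> bool_alg (Suc n) (fiber \<B> ` A') \<Longrightarrow>
      \<exists>Q. finite Q \<and> (\<forall>(d, \<psi>, b)\<in>Q. (d, \<psi>) \<in> \<Psi>2 \<and> length b = d \<and> (\<forall>x. length x = Suc n \<longrightarrow> b @ x \<in> \<psi> \<longrightarrow> x \<in> S)) \<and>
        (\<forall>x\<in>S. \<exists>(d, \<psi>, b)\<in>Q. b @ x \<in> \<psi>)"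
    by (rule family_cells[OF assms(7)]) (rule that)
  \<comment> \<open>One index for each triple of cell families, for \<open>S\<close>,
    \<open>F\<close> and \<open>G\<close>. These are finitely many and are fixed before any of the
    finite parameter sets, so the exponent obtained from them is uniform.\<close>
  define W where "W = (\<lambda>((d1, \<psi>1), (d2, \<psi>2), (d3, \<psi>3)). cell_values n d1 \<psi>1 d2 \<psi>2 d3 \<psi>3)"
  define dim where "dim = (\<lambda>((d1, \<psi>1 :: real list set), (d2, \<psi>2 :: real list set), (d3, \<psi>3 :: real list set)). d1 + d2 + d3 + n)"
  have "W i \<in> D (dim i + 2)" if "i \<in> \<Psi>1 \<times> \<Psi>2 \<times> \<Psi>2" for i
    using that \<Psi>1(2) \<Psi>2(2) D_cell_values by (auto simp: W_def dim_def)
  then have "\<exists>N. \<forall>i\<in>\<Psi>1 \<times> \<Psi>2 \<times> \<Psi>2. \<forall>t. length t = dim i \<longrightarrow> admissible (W i) t \<longrightarrow>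
      (\<exists>s0>0. \<forall>z y. t @ [z, y] \<in> W i \<longrightarrow> 0 < z \<longrightarrow> z < s0 \<longrightarrow> z ^ N \<le> y)"
    using \<Psi>1(1) \<Psi>2(1)
    by (intro uniform_exponent_finite[OF assms(2), of _ W "\<lambda>i. dim i + 2"] finite_cartesian_product)
  then obtain N where N0: "\<forall>i\<in>\<Psi>1 \<times> \<Psi>2 \<times> \<Psi>2. \<forall>t. length t = dim i \<longrightarrow> admissible (W i) t \<longrightarrow>
      (\<exists>s0>0. \<forall>z y. t @ [z, y] \<in> W i \<longrightarrow> 0 < z \<longrightarrow> z < s0 \<longrightarrow> z ^ N \<le> y)" ..
  have N: "\<exists>s0>0. \<forall>z y. t @ [z, y] \<in> cell_values n d1 \<psi>1 d2 \<psi>2 d3 \<psi>3 \<longrightarrow> 0 < z \<longrightarrow> z < s0 \<longrightarrow> z ^ N \<le> y"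
    if "(d1, \<psi>1) \<in> \<Psi>1" "(d2, \<psi>2) \<in> \<Psi>2" "(d3, \<psi>3) \<in> \<Psi>2" "length t = d1 + d2 + d3 + n"
      "admissible (cell_values n d1 \<psi>1 d2 \<psi>2 d3 \<psi>3) t" for d1 \<psi>1 d2 \<psi>2 d3 \<psi>3 t
    using N0[rule_format, of "((d1, \<psi>1), (d2, \<psi>2), (d3, \<psi>3))" t] that by (simp add: W_def dim_def)
  show ?thesis
  \<comment> \<open>\<open>N\<close> factors of \<open>g\<close> compensate the zero of
    \<open>f\<close>; the additional one makes the quotient tend to 0, and makes the exponent
    positive.\<close>
  proof (intro exI[of _ "Suc N"] conjI allI impI, goal_cases)
    case (2 A' B' B'' S F G f g)
    then have A': "finite A'" "A' \<subseteq> Rn m" and B': "finite B'" "B' \<subseteq> Rn k" and B'': "finite B''" "B'' \<subseteq> Rn k"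
      and S: "S \<in> bool_alg n (fiber \<A> ` A')" "lclosed n S"
      and F: "F \<in> bool_alg (Suc n) (fiber \<B> ` B')" "F \<in> D (Suc n)" "F = lgraph_on (Rn n) f"
      and G: "G \<in> bool_alg (Suc n) (fiber \<B> ` B'')" "G \<in> D (Suc n)" "G = lgraph_on (Rn n) g"
      and cont: "lcont_on S f" "lcont_on S g" and zero: "\<forall>x\<in>S. f x = 0 \<longrightarrow> g x = 0"
      using D_subset[OF assms(3)] D_subset[OF assms(6)] by auto
    have SD: "S \<in> D n" using A'(2) D_fiber[OF assms(4)] by (intro bool_alg_D[OF S(1)]) (auto simp: Rn_def)
    have Sn: "length x = n" if "x \<in> S" for x using D_length[OF SD that] .
    have Ff: "x @ [u] \<in> F \<longleftrightarrow> u = f x" and Gg: "x @ [u] \<in> G \<longleftrightarrow> u = g x" if "length x = n" for x u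
      using that by (auto simp: F(3) G(3) lgraph_on_def Rn_def)
    define h where "h x = (if f x = 0 then 0 else g x ^ Suc N / f x)" for x
    \<comment> \<open>The graph of \<open>h\<close> without division: \<open>u\<close> and
      \<open>v\<close> are the values of \<open>f\<close> and \<open>g\<close>, read off from the
      definable sets \<open>F\<close> and \<open>G\<close>.\<close>
    have "{x @ [y] | x y. length x = n \<and> (x \<in> S \<and> (\<exists>u v. x @ [u] \<in> F \<and> x @ [v] \<in> G \<and>
        ((u = 0 \<and> y = 0) \<or> (u \<noteq> 0 \<and> y * u = v ^ Suc N))))} \<in> D (Suc n)" (is "?H \<in> _")
      by (intro D_I_snoc dfn_intros dfn_mem[OF SD] dfn_mem[OF F(2)] dfn_mem[OF G(2)])
    moreover have "?H = lgraph_on S h"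
    proof -
      have key: "(\<exists>u v. x @ [u] \<in> F \<and> x @ [v] \<in> G \<and> ((u = 0 \<and> y = 0) \<or> (u \<noteq> 0 \<and> y * u = v ^ Suc N))) \<longleftrightarrow> y = h x"
        if "length x = n" for x y
        using that by (auto simp: Ff Gg h_def eq_divide_eq simp del: power_Suc)
      show ?thesis
      proof (intro equalityI subsetI)
        fix z assume "z \<in> ?H"
        then obtain x y where xy: "z = x @ [y]" "length x = n" "x \<in> S"
            "\<exists>u v. x @ [u] \<in> F \<and> x @ [v] \<in> G \<and> ((u = 0 \<and> y = 0) \<or> (u \<noteq> 0 \<and> y * u = v ^ Suc N))"
          by blast
        then have "y = h x" by (simp only: key)
        then show "z \<in> lgraph_on S h" using xy by (auto simp: lgraph_on_def)
      next
        fix z assume "z \<in> lgraph_on S h"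
        then obtain x where x: "z = x @ [h x]" "x \<in> S" by (auto simp: lgraph_on_def)
        then show "z \<in> ?H"
          using key[OF Sn[OF x(2)], of "h x"] Sn[OF x(2)] by blast
      qed
    qed
    ultimately have "lgraph_on S h \<in> D (Suc n)" by simp
    moreover have "g x ^ Suc N = h x * f x" if "x \<in> S" for x
      using zero that by (auto simp: h_def)
    moreover have "lcont_on S h"
      unfolding lcont_on_tendsto
    proof
      fix x0 assume x0: "x0 \<in> S"
      have lim: "(f \<longlongrightarrow> f x0) (lnhds S x0)" "(g \<longlongrightarrow> g x0) (lnhds S x0)"
        using cont x0 unfolding lcont_on_tendsto by blast+
      show "(h \<longlongrightarrow> h x0) (lnhds S x0)"
      proof (cases "f x0 = 0")
        case False
        have "((\<lambda>x. g x ^ Suc N / f x) \<longlongrightarrow> g x0 ^ Suc N / f x0) (lnhds S x0)"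
          by (intro tendsto_intros lim False)
        moreover have "\<forall>\<^sub>F x in lnhds S x0. g x ^ Suc N / f x = h x"
          using tendsto_imp_eventually_ne[OF lim(1) False] by eventually_elim (simp add: h_def)
        ultimately have "(h \<longlongrightarrow> g x0 ^ Suc N / f x0) (lnhds S x0)" by (rule Lim_transform_eventually)
        moreover have "h x0 = g x0 ^ Suc N / f x0" using False by (simp add: h_def)
        ultimately show ?thesis by simp
      next
        case True
        then have "g x0 = 0" using zero x0 by blast
        obtain Q1 where Q1: "finite Q1" "\<And>d \<psi> b. (d, \<psi>, b) \<in> Q1 \<Longrightarrow> (d, \<psi>) \<in> \<Psi>1 \<and> length b = d \<and> (\<forall>x. length x = n \<longrightarrow> b @ x \<in> \<psi> \<longrightarrow> x \<in> S)"
            "\<And>x. x \<in> S \<Longrightarrow> \<exists>(d, \<psi>, b)\<in>Q1. b @ x \<in> \<psi>"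
          using \<Psi>1(3)[OF A' S(1)] by fast
        obtain Q2 where Q2: "finite Q2" "\<And>d \<psi> b. (d, \<psi>, b) \<in> Q2 \<Longrightarrow> (d, \<psi>) \<in> \<Psi>2 \<and> length b = d \<and> (\<forall>x. length x = Suc n \<longrightarrow> b @ x \<in> \<psi> \<longrightarrow> x \<in> F)"
            "\<And>x. x \<in> F \<Longrightarrow> \<exists>(d, \<psi>, b)\<in>Q2. b @ x \<in> \<psi>"
          using \<Psi>2(3)[OF B' F(1)] by fast
        obtain Q3 where Q3: "finite Q3" "\<And>d \<psi> b. (d, \<psi>, b) \<in> Q3 \<Longrightarrow> (d, \<psi>) \<in> \<Psi>2 \<and> length b = d \<and> (\<forall>x. length x = Suc n \<longrightarrow> b @ x \<in> \<psi> \<longrightarrow> x \<in> G)"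
            "\<And>x. x \<in> G \<Longrightarrow> \<exists>(d, \<psi>, b)\<in>Q3. b @ x \<in> \<psi>"
          using \<Psi>2(3)[OF B'' G(1)] by fast
        have near: "\<forall>\<^sub>F x in lnhds S x0. x \<in> S \<and> x @ x0 \<in> unit_box n"
          unfolding eventually_lnhds
        proof (intro exI[of _ 1] conjI ballI impI)
          fix x assume "x \<in> S" "ldist x0 x < 1"
          then show "x @ x0 \<in> unit_box n"
            using coordinate_le_ldist[of _ x0 x] Sn x0 by (force simp: unit_box_def nth_append abs_minus_commute)
        qed auto
        have cell: "\<forall>\<^sub>F x in lnhds S x0. b1 @ x \<in> \<psi>1 \<longrightarrow> b2 @ x @ [f x] \<in> \<psi>2 \<longrightarrow> b3 @ x @ [g x] \<in> \<psi>3 \<longrightarrow>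
            g x \<noteq> 0 \<longrightarrow> \<bar>g x\<bar> ^ N \<le> \<bar>f x\<bar>"
          if q: "(d1, \<psi>1, b1) \<in> Q1" "(d2, \<psi>2, b2) \<in> Q2" "(d3, \<psi>3, b3) \<in> Q3" for d1 \<psi>1 b1 d2 \<psi>2 b2 d3 \<psi>3 b3
        proof -
          note q' = Q1(2)[OF q(1)] Q2(2)[OF q(2)] Q3(2)[OF q(3)]
          let ?W = "cell_values n d1 \<psi>1 d2 \<psi>2 d3 \<psi>3"
          let ?t = "b1 @ b2 @ b3 @ x0"
          note W_iff = cell_values_iff[of b1 d1 b2 d2 b3 d3 x0 n _ _ \<psi>1 \<psi>2 \<psi>3]
          \<comment> \<open>The three cells lie inside \<open>S\<close>, \<open>F\<close> and
            \<open>G\<close>, so every pair in this fibre comes from a point of \<open>S\<close> in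
            the box with \<open>u = f x\<close> and \<open>v = g x\<close>; compactness of the box
            then applies.\<close>
          have "admissible ?W ?t"
            unfolding admissible_def
          proof (intro allI impI)
            fix s :: real assume "0 < s"
            from positive_bound_on_box[OF S(2) cont zero Sn[OF x0] this]
            obtain \<rho> where \<rho>: "\<rho> > 0" "\<forall>x\<in>S. (\<forall>i<n. \<bar>x ! i - x0 ! i\<bar> \<le> 1) \<longrightarrow> s \<le> \<bar>g x\<bar> \<longrightarrow> \<rho> \<le> \<bar>f x\<bar>"
              by blast
            show "\<exists>\<rho>. 0 < \<rho> \<and> (\<forall>z y. ?t @ [z, y] \<in> ?W \<longrightarrow> s \<le> z \<longrightarrow> \<rho> \<le> y)"
            proof (intro exI[of _ \<rho>] conjI allI impI \<rho>(1))
              fix z y assume zy: "?t @ [z, y] \<in> ?W" "s \<le> z"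
              then obtain u v x where x: "z = \<bar>v\<bar>" "y = \<bar>u\<bar>" "length x = n" "x @ x0 \<in> unit_box n"
                  "b1 @ x \<in> \<psi>1" "b2 @ x @ [u] \<in> \<psi>2" "b3 @ x @ [v] \<in> \<psi>3"
                using W_iff q' Sn[OF x0] by blast
              have "x \<in> S" using q'(1) x by blast
              moreover have "x @ [u] \<in> F" "x @ [v] \<in> G" using q'(2,3) x by auto
              then have "u = f x" "v = g x" using Ff[OF x(3)] Gg[OF x(3)] by auto
              moreover have "\<forall>i<n. \<bar>x ! i - x0 ! i\<bar> \<le> 1"
                using x(3,4) Sn[OF x0] by (auto simp: unit_box_def nth_append)
              ultimately show "\<rho> \<le> y" using \<rho>(2) x zy(2) by blast
            qed
          qed
          then obtain s0 where s0: "s0 > 0" "\<And>z y. ?t @ [z, y] \<in> ?W \<Longrightarrow> 0 < z \<Longrightarrow> z < s0 \<Longrightarrow> z ^ N \<le> y"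
            using N[of d1 \<psi>1 d2 \<psi>2 d3 \<psi>3 ?t] q' Sn[OF x0] by auto
          have "\<forall>\<^sub>F x in lnhds S x0. \<bar>g x\<bar> < s0"
            using order_tendstoD(2)[OF tendsto_rabs[OF lim(2)], of s0] s0(1) \<open>g x0 = 0\<close> by simp
          with near show ?thesis
          proof eventually_elim
            case (elim x)
            show ?case
            proof (intro impI)
              assume "b1 @ x \<in> \<psi>1" "b2 @ x @ [f x] \<in> \<psi>2" "b3 @ x @ [g x] \<in> \<psi>3" "g x \<noteq> 0"
              then have "?t @ [\<bar>g x\<bar>, \<bar>f x\<bar>] \<in> ?W"
                using W_iff q' Sn[OF x0] Sn elim by blast
              then show "\<bar>g x\<bar> ^ N \<le> \<bar>f x\<bar>" using s0(2) elim \<open>g x \<noteq> 0\<close> by simp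
            qed
          qed
        qed
        \<comment> \<open>For the given parameter sets only finitely many triples of cells occur, so
          the local inequalities hold on one common neighbourhood.\<close>
        have "\<forall>\<^sub>F x in lnhds S x0. \<forall>(d1, \<psi>1, b1)\<in>Q1. \<forall>(d2, \<psi>2, b2)\<in>Q2. \<forall>(d3, \<psi>3, b3)\<in>Q3.
            b1 @ x \<in> \<psi>1 \<longrightarrow> b2 @ x @ [f x] \<in> \<psi>2 \<longrightarrow> b3 @ x @ [g x] \<in> \<psi>3 \<longrightarrow> g x \<noteq> 0 \<longrightarrow> \<bar>g x\<bar> ^ N \<le> \<bar>f x\<bar>"
          unfolding case_prod_unfold eventually_ball_finite_distrib[OF Q1(1)]
            eventually_ball_finite_distrib[OF Q2(1)] eventually_ball_finite_distrib[OF Q3(1)]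
        proof (intro ballI)
          fix q1 q2 q3 assume "q1 \<in> Q1" "q2 \<in> Q2" "q3 \<in> Q3"
          then show "\<forall>\<^sub>F x in lnhds S x0. snd (snd q1) @ x \<in> fst (snd q1) \<longrightarrow>
              snd (snd q2) @ x @ [f x] \<in> fst (snd q2) \<longrightarrow> snd (snd q3) @ x @ [g x] \<in> fst (snd q3) \<longrightarrow>
              g x \<noteq> 0 \<longrightarrow> \<bar>g x\<bar> ^ N \<le> \<bar>f x\<bar>"
            using cell[of "fst q1" "fst (snd q1)" "snd (snd q1)" "fst q2" "fst (snd q2)" "snd (snd q2)"
                "fst q3" "fst (snd q3)" "snd (snd q3)"] by (simp only: prod.collapse)
        qed
        with near have "\<forall>\<^sub>F x in lnhds S x0. norm (h x) \<le> \<bar>g x\<bar>"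
        proof eventually_elim
          case (elim x)
          have x: "x \<in> S" "length x = n" using elim(1) Sn by auto
          have "x @ [f x] \<in> F" "x @ [g x] \<in> G" using Ff[OF x(2)] Gg[OF x(2)] by auto
          then obtain d1 \<psi>1 b1 d2 \<psi>2 b2 d3 \<psi>3 b3 where "(d1, \<psi>1, b1) \<in> Q1" "b1 @ x \<in> \<psi>1"
              "(d2, \<psi>2, b2) \<in> Q2" "b2 @ x @ [f x] \<in> \<psi>2" "(d3, \<psi>3, b3) \<in> Q3" "b3 @ x @ [g x] \<in> \<psi>3"
            using Q1(3)[OF x(1)] Q2(3) Q3(3) by fast
          then have *: "g x \<noteq> 0 \<longrightarrow> \<bar>g x\<bar> ^ N \<le> \<bar>f x\<bar>" using elim(2) by fast
          show "norm (h x) \<le> \<bar>g x\<bar>"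
          \<comment> \<open>In the excluded cases \<open>h x\<close> is 0, by its default value
            where \<open>f\<close> vanishes and by its numerator where only \<open>g\<close>
            does.\<close>
          proof (cases "f x = 0 \<or> g x = 0")
            case False
            then have "\<bar>g x\<bar> * \<bar>g x\<bar> ^ N \<le> \<bar>g x\<bar> * \<bar>f x\<bar>" using * by (intro mult_left_mono) auto
            then show ?thesis using False by (simp add: h_def abs_mult power_abs field_simps)
          qed (auto simp: h_def)
        qed
        moreover have "((\<lambda>x. \<bar>g x\<bar>) \<longlongrightarrow> 0) (lnhds S x0)"
          using tendsto_rabs[OF lim(2)] \<open>g x0 = 0\<close> by simp
        ultimately have "(h \<longlongrightarrow> 0) (lnhds S x0)" by (rule Lim_null_comparison)
        then show ?thesis using True by (simp add: h_def)
      qed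
    qed
    ultimately show ?case by blast
  qed simp
qed

end
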